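(* Let $L\supseteq\{+,-,0,1,<\}$ be a first-order language and let $T$ be a complete o-minimal $L$-theory extending the theory of ordered abelian groups with a distinguished positive element $1$. Then the theory $T^d$ of dense pairs of models of $T$ is not dp-minimal.
   Context: **Dense pairs.** Let $L^d=L\cup\{U\}$ with $U$ a new unary relation symbol. A dense pair of models of $T$ is an $L^d$-structure $(\mathcal M,\mathcal N)$ where $\mathcal M\models T$ and $U$ is interpreted as the universe $N$ of a proper elementary substructure $\mathcal N$ of $\mathcal M$ such that $N$ is dense in $M$ (for all $a<b$ in $M$ there is $c\in N$ with $a<c<b$). $T^d$ is the $L^d$-theory of dense pairs of models of $T$; it is known to be complete. **dp-minimality.** A theory $T'$ is dp-minimal if for any model $\mathcal M$ of $T'$ and any formulas $\phi(x;y)$ and $\psi(x;y)$ with $|x|=1$, there are no sequences $(a_i)_{i\in\mathbb N}$ and $(b_i)_{i\in\mathbb N}$ from $M^{|y|}$ such that for all $i,j\in\mathbb N$ the set of formulas $$\{\phi(x;a_i),\psi(x;b_j)\}\cup\{\neg\phi(x;a_k):k\ne i\}\cup\{\neg\psi(x;b_l):l\ne j\}$$ has a realization in $\mathcal M$. *)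

theory Defs
  imports Main
begin

section \<open>First-order languages, formulas and structures\<close>

text \<open>The symbols of a language are all elements of the types 'f (functions, with constants as
  functions of arity 0) and 'r (relations).\<close>

record ('f, 'r) language =
  fun_ar :: "'f \<Rightarrow> nat"
  rel_ar :: "'r \<Rightarrow> nat"

datatype 'f tm = Var nat | Fn 'f "'f tm list"

datatype ('f, 'r) fm =
    FEq "'f tm" "'f tm"
  | FRel 'r "'f tm list"
  | FNot "('f, 'r) fm"
  | FAnd "('f, 'r) fm" "('f, 'r) fm"
  | FEx nat "('f, 'r) fm"

abbreviation FOr :: "('f, 'r) fm \<Rightarrow> ('f, 'r) fm \<Rightarrow> ('f, 'r) fm" where
  "FOr p q \<equiv> FNot (FAnd (FNot p) (FNot q))"

abbreviation FImp :: "('f, 'r) fm \<Rightarrow> ('f, 'r) fm \<Rightarrow> ('f, 'r) fm" where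
  "FImp p q \<equiv> FNot (FAnd p (FNot q))"

abbreviation FAll :: "nat \<Rightarrow> ('f, 'r) fm \<Rightarrow> ('f, 'r) fm" where
  "FAll x p \<equiv> FNot (FEx x (FNot p))"

primrec wf_tm :: "('f, 'r, 'z) language_scheme \<Rightarrow> 'f tm \<Rightarrow> bool" where
  "wf_tm L (Var x) = True"
| "wf_tm L (Fn f ts) = (length ts = fun_ar L f \<and> list_all (\<lambda>b. b) (map (wf_tm L) ts))"

primrec wf_fm :: "('f, 'r, 'z) language_scheme \<Rightarrow> ('f, 'r) fm \<Rightarrow> bool" where
  "wf_fm L (FEq s t) = (wf_tm L s \<and> wf_tm L t)"
| "wf_fm L (FRel r ts) = (length ts = rel_ar L r \<and> list_all (wf_tm L) ts)"
| "wf_fm L (FNot p) = wf_fm L p"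
| "wf_fm L (FAnd p q) = (wf_fm L p \<and> wf_fm L q)"
| "wf_fm L (FEx x p) = wf_fm L p"

primrec vars_tm :: "'f tm \<Rightarrow> nat set" where
  "vars_tm (Var x) = {x}"
| "vars_tm (Fn f ts) = \<Union> (set (map vars_tm ts))"

primrec fv :: "('f, 'r) fm \<Rightarrow> nat set" where
  "fv (FEq s t) = vars_tm s \<union> vars_tm t"
| "fv (FRel r ts) = \<Union> (set (map vars_tm ts))"
| "fv (FNot p) = fv p"
| "fv (FAnd p q) = fv p \<union> fv q"
| "fv (FEx x p) = fv p - {x}"

definition sentence :: "('f, 'r, 'z) language_scheme \<Rightarrow> ('f, 'r) fm \<Rightarrow> bool" where
  "sentence L p \<longleftrightarrow> wf_fm L p \<and> fv p = {}"

definition is_theory :: "('f, 'r, 'z) language_scheme \<Rightarrow> ('f, 'r) fm set \<Rightarrow> bool" where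
  "is_theory L T \<longleftrightarrow> (\<forall>p\<in>T. sentence L p)"

record ('f, 'r, 'm) interp =
  univ :: "'m set"
  fint :: "'f \<Rightarrow> 'm list \<Rightarrow> 'm"
  rint :: "'r \<Rightarrow> 'm list set"

definition is_struct :: "('f, 'r, 'z) language_scheme \<Rightarrow> ('f, 'r, 'm) interp \<Rightarrow> bool" where
  "is_struct L M \<longleftrightarrow>
     univ M \<noteq> {} \<and>
     (\<forall>f as. length as = fun_ar L f \<and> set as \<subseteq> univ M \<longrightarrow> fint M f as \<in> univ M) \<and>
     (\<forall>r. rint M r \<subseteq> {as. length as = rel_ar L r \<and> set as \<subseteq> univ M})"

primrec eval :: "('f, 'r, 'm) interp \<Rightarrow> (nat \<Rightarrow> 'm) \<Rightarrow> 'f tm \<Rightarrow> 'm" where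
  "eval M e (Var x) = e x"
| "eval M e (Fn f ts) = fint M f (map (eval M e) ts)"

primrec sat :: "('f, 'r, 'm) interp \<Rightarrow> (nat \<Rightarrow> 'm) \<Rightarrow> ('f, 'r) fm \<Rightarrow> bool" where
  "sat M e (FEq s t) = (eval M e s = eval M e t)"
| "sat M e (FRel r ts) = (map (eval M e) ts \<in> rint M r)"
| "sat M e (FNot p) = (\<not> sat M e p)"
| "sat M e (FAnd p q) = (sat M e p \<and> sat M e q)"
| "sat M e (FEx x p) = (\<exists>a\<in>univ M. sat M (e(x := a)) p)"

lemma eval_cong:
  assumes "\<And>x. x \<in> vars_tm t \<Longrightarrow> e x = e' x"
  shows "eval M e t = eval M e' t"
  using assms
proof (induction t)
  case (Var x)
  then show ?case by simp
next
  case (Fn f ts)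
  have "map (eval M e) ts = map (eval M e') ts"
  proof (rule map_cong[OF refl])
    fix t assume t: "t \<in> set ts"
    show "eval M e t = eval M e' t"
    proof (rule Fn.IH[OF t])
      fix x assume "x \<in> vars_tm t"
      with t have "x \<in> vars_tm (Fn f ts)" by auto
      then show "e x = e' x" by (rule Fn.prems)
    qed
  qed
  then show ?case by (simp only: eval.simps)
qed

lemma sat_cong:
  assumes "\<And>x. x \<in> fv p \<Longrightarrow> e x = e' x"
  shows "sat M e p \<longleftrightarrow> sat M e' p"
  using assms
proof (induction p arbitrary: e e')
  case (FEq s t)
  have "eval M e s = eval M e' s" "eval M e t = eval M e' t"
    by (rule eval_cong, rule FEq.prems, simp)+
  then show ?case by (simp only: sat.simps)
next
  case (FRel r ts)
  have "map (eval M e) ts = map (eval M e') ts"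
    by (rule map_cong[OF refl], rule eval_cong, rule FRel.prems) auto
  then show ?case by (simp only: sat.simps)
next
  case (FNot p)
  have "sat M e p \<longleftrightarrow> sat M e' p" by (rule FNot.IH, rule FNot.prems) simp
  then show ?case by (simp only: sat.simps)
next
  case (FAnd p q)
  have "sat M e p \<longleftrightarrow> sat M e' p" by (rule FAnd.IH(1), rule FAnd.prems) simp
  moreover have "sat M e q \<longleftrightarrow> sat M e' q" by (rule FAnd.IH(2), rule FAnd.prems) simp
  ultimately show ?case by (simp only: sat.simps)
next
  case (FEx x p)
  have "sat M (e(x := a)) p \<longleftrightarrow> sat M (e'(x := a)) p" for a
  proof (rule FEx.IH)
    fix y assume "y \<in> fv p"
    then show "(e(x := a)) y = (e'(x := a)) y" using FEx.prems[of y] by simp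
  qed
  then show ?case by (simp only: sat.simps)
qed

definition holds :: "('f, 'r, 'm) interp \<Rightarrow> ('f, 'r) fm \<Rightarrow> bool" where
  "holds M p \<longleftrightarrow> (\<forall>e. range e \<subseteq> univ M \<longrightarrow> sat M e p)"

definition is_model ::
  "('f, 'r, 'z) language_scheme \<Rightarrow> ('f, 'r) fm set \<Rightarrow> ('f, 'r, 'm) interp \<Rightarrow> bool" where
  "is_model L T M \<longleftrightarrow> is_struct L M \<and> (\<forall>p\<in>T. holds M p)"

text \<open>HOL cannot quantify over types inside a formula. Notions that quantify over all models
  therefore carry an argument of type 'm itself and range over the models whose universe is a
  subset of 'm. If 'm is at least as large as the set of formulas, the downward
  Loewenheim-Skolem theorem makes each notion below independent of the choice of 'm.\<close>

definition entails ::
  "'m itself \<Rightarrow> ('f, 'r, 'z) language_scheme \<Rightarrow> ('f, 'r) fm set \<Rightarrow> ('f, 'r) fm \<Rightarrow> bool" where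
  "entails _ L T p \<longleftrightarrow> (\<forall>M :: ('f, 'r, 'm) interp. is_model L T M \<longrightarrow> holds M p)"

definition complete_theory ::
  "'m itself \<Rightarrow> ('f, 'r, 'z) language_scheme \<Rightarrow> ('f, 'r) fm set \<Rightarrow> bool" where
  "complete_theory ty L T \<longleftrightarrow>
     is_theory L T \<and>
     (\<exists>M :: ('f, 'r, 'm) interp. is_model L T M) \<and>
     (\<forall>p. sentence L p \<longrightarrow> entails ty L T p \<or> entails ty L T (FNot p))"

definition elementary_sub ::
  "('f, 'r, 'z) language_scheme \<Rightarrow> ('f, 'r, 'm) interp \<Rightarrow> ('f, 'r, 'm) interp \<Rightarrow> bool" where
  "elementary_sub L N M \<longleftrightarrow>
     is_struct L N \<and> is_struct L M \<and> univ N \<subseteq> univ M \<and>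
     (\<forall>f as. length as = fun_ar L f \<and> set as \<subseteq> univ N \<longrightarrow> fint N f as = fint M f as) \<and>
     (\<forall>r. rint N r = {as \<in> rint M r. set as \<subseteq> univ N}) \<and>
     (\<forall>p e. wf_fm L p \<and> range e \<subseteq> univ N \<longrightarrow> (sat N e p \<longleftrightarrow> sat M e p))"


section \<open>Languages containing \<open>+, -, 0, 1, <\<close>\<close>

record ('f, 'r) og_language = "('f, 'r) language" +
  plus_sym :: 'f
  minus_sym :: 'f
  zero_sym :: 'f
  one_sym :: 'f
  less_sym :: 'r

text \<open>The symbol \<open>-\<close> is the unary inverse of the group. The two constants need not be assumed
  different: no consistent extension of the theory below identifies them.\<close>

definition og_arities :: "('f, 'r, 'z) og_language_scheme \<Rightarrow> bool" where
  "og_arities L \<longleftrightarrow>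
     fun_ar L (plus_sym L) = 2 \<and> fun_ar L (minus_sym L) = 1 \<and>
     fun_ar L (zero_sym L) = 0 \<and> fun_ar L (one_sym L) = 0 \<and> rel_ar L (less_sym L) = 2"

definition ordered_abelian_group_axioms ::
  "('f, 'r, 'z) og_language_scheme \<Rightarrow> ('f, 'r) fm set" where
  "ordered_abelian_group_axioms L =
     (let add = (\<lambda>s t. Fn (plus_sym L) [s, t]);
          neg = (\<lambda>t. Fn (minus_sym L) [t]);
          zero = Fn (zero_sym L) [];
          one = Fn (one_sym L) [];
          lt = (\<lambda>s t. FRel (less_sym L) [s, t]);
          x = Var 0; y = Var 1; z = Var 2;
          all2 = (\<lambda>p. FAll 0 (FAll 1 p));
          all3 = (\<lambda>p. FAll 0 (FAll 1 (FAll 2 p)))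
      in {all3 (FEq (add (add x y) z) (add x (add y z))),
          all2 (FEq (add x y) (add y x)),
          FAll 0 (FEq (add x zero) x),
          FAll 0 (FEq (add x (neg x)) zero),
          FAll 0 (FNot (lt x x)),
          all3 (FImp (FAnd (lt x y) (lt y z)) (lt x z)),
          all2 (FOr (lt x y) (FOr (FEq x y) (lt y x))),
          all3 (FImp (lt x y) (lt (add x z) (add y z))),
          lt zero one})"

abbreviation less_in ::
  "('f, 'r, 'z) og_language_scheme \<Rightarrow> ('f, 'r, 'm) interp \<Rightarrow> 'm \<Rightarrow> 'm \<Rightarrow> bool" where
  "less_in L M a b \<equiv> [a, b] \<in> rint M (less_sym L)"


section \<open>O-minimality\<close>

definition definable_sets ::
  "('f, 'r, 'z) language_scheme \<Rightarrow> ('f, 'r, 'm) interp \<Rightarrow> 'm set set" where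
  "definable_sets L M =
     {{a \<in> univ M. sat M (e(x := a)) p} | p e x. wf_fm L p \<and> range e \<subseteq> univ M}"

definition points_and_intervals ::
  "('f, 'r, 'z) og_language_scheme \<Rightarrow> ('f, 'r, 'm) interp \<Rightarrow> 'm set set" where
  "points_and_intervals L M =
     {{a} | a. a \<in> univ M} \<union>
     {{c \<in> univ M. less_in L M a c \<and> less_in L M c b} | a b. a \<in> univ M \<and> b \<in> univ M} \<union>
     {{c \<in> univ M. less_in L M a c} | a. a \<in> univ M} \<union>
     {{c \<in> univ M. less_in L M c b} | b. b \<in> univ M} \<union>
     {univ M}"

definition o_minimal_struct ::
  "('f, 'r, 'z) og_language_scheme \<Rightarrow> ('f, 'r, 'm) interp \<Rightarrow> bool" where
  "o_minimal_struct L M \<longleftrightarrow>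
     is_struct L M \<and>
     (\<forall>a\<in>univ M. \<not> less_in L M a a) \<and>
     (\<forall>a\<in>univ M. \<forall>b\<in>univ M. \<forall>c\<in>univ M.
        less_in L M a b \<and> less_in L M b c \<longrightarrow> less_in L M a c) \<and>
     (\<forall>a\<in>univ M. \<forall>b\<in>univ M. less_in L M a b \<or> a = b \<or> less_in L M b a) \<and>
     (\<forall>D\<in>definable_sets L M. \<exists>F. finite F \<and> F \<subseteq> points_and_intervals L M \<and> D = \<Union> F)"

definition o_minimal_theory ::
  "'m itself \<Rightarrow> ('f, 'r, 'z) og_language_scheme \<Rightarrow> ('f, 'r) fm set \<Rightarrow> bool" where
  "o_minimal_theory _ L T \<longleftrightarrow>
     (\<forall>M :: ('f, 'r, 'm) interp. is_model L T M \<longrightarrow> o_minimal_struct L M)"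


section \<open>Dense pairs\<close>

datatype 'r pair_rel = Base 'r | U

definition pair_language :: "('f, 'r, 'z) language_scheme \<Rightarrow> ('f, 'r pair_rel) language" where
  "pair_language L =
     \<lparr>fun_ar = fun_ar L, rel_ar = (\<lambda>s. case s of Base r \<Rightarrow> rel_ar L r | U \<Rightarrow> 1)\<rparr>"

definition reduct :: "('f, 'r pair_rel, 'm) interp \<Rightarrow> ('f, 'r, 'm) interp" where
  "reduct P = \<lparr>univ = univ P, fint = fint P, rint = (\<lambda>r. rint P (Base r))\<rparr>"

definition dense_pair ::
  "('f, 'r, 'z) og_language_scheme \<Rightarrow> ('f, 'r) fm set \<Rightarrow> ('f, 'r pair_rel, 'm) interp \<Rightarrow> bool"
  where
  "dense_pair L T P \<longleftrightarrow>
     is_struct (pair_language L) P \<and>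
     is_model L T (reduct P) \<and>
     (\<exists>N. elementary_sub L N (reduct P) \<and> univ N \<noteq> univ P \<and>
          univ N = {a \<in> univ P. [a] \<in> rint P U} \<and>
          (\<forall>a\<in>univ P. \<forall>b\<in>univ P. less_in L (reduct P) a b \<longrightarrow>
             (\<exists>c\<in>univ N. less_in L (reduct P) a c \<and> less_in L (reduct P) c b)))"

definition dense_pair_theory ::
  "'m itself \<Rightarrow> ('f, 'r, 'z) og_language_scheme \<Rightarrow> ('f, 'r) fm set \<Rightarrow> ('f, 'r pair_rel) fm set"
  where
  "dense_pair_theory _ L T =
     {p. sentence (pair_language L) p \<and>
         (\<forall>P :: ('f, 'r pair_rel, 'm) interp. dense_pair L T P \<longrightarrow> holds P p)}"


section \<open>Dp-minimality\<close>

text \<open>In a formula with free variables among \<open>0, ..., n\<close>, variable 0 plays the role of x and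
  variables \<open>1, ..., n\<close> that of the tuple y, so \<open>p(c; as)\<close> is evaluated at the assignment
  \<open>(!) (c # as)\<close>. Its values beyond position n are irrelevant by \<open>sat_cong\<close>.\<close>

definition dp_minimal ::
  "'m itself \<Rightarrow> ('f, 'r, 'z) language_scheme \<Rightarrow> ('f, 'r) fm set \<Rightarrow> bool" where
  "dp_minimal _ L T \<longleftrightarrow>
     (\<forall>M :: ('f, 'r, 'm) interp. is_model L T M \<longrightarrow>
       (\<forall>n p q. wf_fm L p \<and> fv p \<subseteq> {0..n} \<and> wf_fm L q \<and> fv q \<subseteq> {0..n} \<longrightarrow>
         \<not> (\<exists>(a :: nat \<Rightarrow> 'm list) (b :: nat \<Rightarrow> 'm list).
              (\<forall>i. length (a i) = n \<and> set (a i) \<subseteq> univ M) \<and>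
              (\<forall>j. length (b j) = n \<and> set (b j) \<subseteq> univ M) \<and>
              (\<forall>i j. \<exists>c\<in>univ M.
                 sat M ((!) (c # a i)) p \<and> sat M ((!) (c # b j)) q \<and>
                 (\<forall>k. k \<noteq> i \<longrightarrow> \<not> sat M ((!) (c # a k)) p) \<and>
                 (\<forall>l. l \<noteq> j \<longrightarrow> \<not> sat M ((!) (c # b l)) q)))))"

end

(*
  In a dense pair (M, N) pick x in M but not in N. By elementarity the multiples of x lie in pairwise
  different cosets of N, and all these cosets are dense. So the formulas y1 < v < y2, for the
  intervals (i, i + 1), and U(v - y), for y = j x, form the forbidden pattern.

  A dense pair exists for the following reason. Take an element a of an elementary extension M' of a
  model M and, successively, points b between any two given elements such that a is not algebraic
  over all the points b. Then the algebraic closure N of these points is dense in M', it is an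
  elementary substructure (a definable set is finite or contains an interval, hence some b), and it
  omits a. That b can be chosen at each step is the exchange property: for a relation R(x, y) with
  uniformly finite fibres over y, only finitely many x have infinitely many y. Uniformity comes
  from the o-minimality of all models of T. Compactness and the bound on the cardinality are
  obtained at once by taking, as elements of M', Skolem terms in a and the points b up to
  equality on an ultrafilter of valuations of these terms in M.
*)
theory Submission
  imports Defs
begin

section \<open>Renaming and auxiliary formulas\<close>

text \<open>Existence of a dense pair carries most of the weight: if the type held none,
  \<open>dense_pair_theory\<close> would contain every sentence, have no model and be dp-minimal
  vacuously. The obstacle is circularity. Density forces points also between elements that involve
  a, yet a must stay outside the algebraic closure of all these points. So a cannot be adjoined to a
  finished N. Instead the dependence is kept in the terms: \<open>Btw s t\<close> takes its value
  after those of \<open>s\<close> and \<open>t\<close>, and any finite number of non-algebraicity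
  conditions is met by suitable values in M itself. Such conditions are negated first-order formulas
  only because finiteness is first-order: no interval of solutions. This needs a dense order, which
  has to be derived from o-minimality together with the group structure. The group is used again at
  the end: the element 1 supplies infinitely many disjoint intervals, and unique division supplies
  the cosets.\<close>

lemma finite_vars_tm [simp]: "finite (vars_tm t)"
  by (induction t) auto

lemma finite_fv [simp]: "finite (fv p)"
  by (induction p) auto

primrec ren_tm :: "(nat \<Rightarrow> nat) \<Rightarrow> 'f tm \<Rightarrow> 'f tm" where
  "ren_tm \<sigma> (Var x) = Var (\<sigma> x)"
| "ren_tm \<sigma> (Fn f ts) = Fn f (map (ren_tm \<sigma>) ts)"

primrec ren :: "(nat \<Rightarrow> nat) \<Rightarrow> ('f, 'r) fm \<Rightarrow> ('f, 'r) fm" where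
  "ren \<sigma> (FEq s t) = FEq (ren_tm \<sigma> s) (ren_tm \<sigma> t)"
| "ren \<sigma> (FRel r ts) = FRel r (map (ren_tm \<sigma>) ts)"
| "ren \<sigma> (FNot p) = FNot (ren \<sigma> p)"
| "ren \<sigma> (FAnd p q) = FAnd (ren \<sigma> p) (ren \<sigma> q)"
| "ren \<sigma> (FEx x p) = FEx (\<sigma> x) (ren \<sigma> p)"

lemma wf_ren_tm [simp]: "wf_tm L (ren_tm \<sigma> t) \<longleftrightarrow> wf_tm L t"
  by (induction t) (auto simp: list_all_iff)

lemma wf_ren [simp]: "wf_fm L (ren \<sigma> p) \<longleftrightarrow> wf_fm L p"
  by (induction p) (auto simp: list_all_iff)

lemma eval_ren_tm: "eval M e (ren_tm \<sigma> t) = eval M (\<lambda>i. e (\<sigma> i)) t"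
proof (induction t)
  case (Fn f ts)
  then have "map (eval M e \<circ> ren_tm \<sigma>) ts = map (eval M (\<lambda>i. e (\<sigma> i))) ts" by simp
  then show ?case by (simp only: ren_tm.simps eval.simps map_map)
qed simp

text \<open>\<open>ren\<close> renames bound variables along with free ones, so injectivity alone
  excludes capture.\<close>

lemma sat_ren:
  assumes "inj \<sigma>"
  shows "sat M e (ren \<sigma> p) \<longleftrightarrow> sat M (\<lambda>i. e (\<sigma> i)) p"
proof (induction p arbitrary: e)
  case (FRel r ts)
  have "eval M e \<circ> ren_tm \<sigma> = eval M (\<lambda>i. e (\<sigma> i))"
    by (simp add: eval_ren_tm fun_eq_iff)
  then show ?case by simp
next
  case (FEx x p)
  have "(\<lambda>i. (e(\<sigma> x := a)) (\<sigma> i)) = (\<lambda>i. e (\<sigma> i))(x := a)" for a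
    using assms by (auto simp: fun_eq_iff inj_eq)
  with FEx show ?case by (simp del: fun_upd_apply)
qed (auto simp: eval_ren_tm)

text \<open>Chosen above the whole set and not merely outside it, so that every number from
  \<open>fresh V\<close> on is new and blocks of new variables are available. The inserted 0 gives
  \<open>Max\<close> a meaning for empty \<open>V\<close>.\<close>

definition fresh :: "nat set \<Rightarrow> nat" where
  "fresh V = Suc (Max (insert 0 V))"

lemma fresh_gt: "finite V \<Longrightarrow> x \<in> V \<Longrightarrow> x < fresh V"
  unfolding fresh_def by (auto intro!: le_imp_less_Suc Max_ge)

text \<open>Substitution of the variable \<open>j\<close> for \<open>i\<close>, expressed by a
  quantifier so that no capture has to be treated. For \<open>i = j\<close> the quantifier would
  bind the very value to be kept, hence the case distinction.\<close>

definition ident_fm :: "nat \<Rightarrow> nat \<Rightarrow> ('f, 'r) fm \<Rightarrow> ('f, 'r) fm" where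
  "ident_fm j i p = (if i = j then p else FEx i (FAnd (FEq (Var i) (Var j)) p))"

lemma wf_ident_fm [simp]: "wf_fm L (ident_fm j i p) \<longleftrightarrow> wf_fm L p"
  by (auto simp: ident_fm_def)

lemma sat_ident_fm: "e j \<in> univ M \<Longrightarrow> sat M e (ident_fm j i p) \<longleftrightarrow> sat M (e(i := e j)) p"
  by (auto simp: ident_fm_def)

lemma wf_foldr_ident_fm [simp]: "wf_fm L (foldr (ident_fm j) is p) \<longleftrightarrow> wf_fm L p"
  by (induction "is") auto

lemma sat_foldr_ident_fm:
  assumes "e j \<in> univ M"
  shows "sat M e (foldr (ident_fm j) is p) \<longleftrightarrow>
    sat M (\<lambda>i. if i \<in> set is then e j else e i) p"
  using assms
proof (induction "is" arbitrary: e)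
  case (Cons k ks)
  let ?e = "e(k := e j)"
  have "sat M e (foldr (ident_fm j) (k # ks) p) \<longleftrightarrow>
      sat M (\<lambda>i. if i \<in> set ks then ?e j else ?e i) p"
  proof -
    have "sat M ?e (foldr (ident_fm j) ks p) \<longleftrightarrow>
        sat M (\<lambda>i. if i \<in> set ks then ?e j else ?e i) p"
      by (rule Cons.IH) (use Cons.prems in simp)
    then show ?thesis
      by (simp only: foldr.simps o_apply sat_ident_fm[of e j M, OF Cons.prems])
  qed
  moreover have "(\<lambda>i. if i \<in> set ks then ?e j else ?e i) =
      (\<lambda>i. if i \<in> set (k # ks) then e j else e i)" by auto
  ultimately show ?case by simp
qed simp

definition differ_fm :: "nat \<Rightarrow> nat list \<Rightarrow> ('f, 'r) fm \<Rightarrow> ('f, 'r) fm" where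
  "differ_fm x vs p = foldr (\<lambda>v. FAnd (FNot (FEq (Var x) (Var v)))) vs p"

lemma wf_differ_fm [simp]: "wf_fm L (differ_fm x vs p) \<longleftrightarrow> wf_fm L p"
  unfolding differ_fm_def by (induction vs) auto

lemma sat_differ_fm: "sat M e (differ_fm x vs p) \<longleftrightarrow> sat M e p \<and> (\<forall>v\<in>set vs. e x \<noteq> e v)"
  unfolding differ_fm_def by (induction vs) auto

abbreviation FLess :: "('f, 'r, 'z) og_language_scheme \<Rightarrow> nat \<Rightarrow> nat \<Rightarrow> ('f, 'r) fm" where
  "FLess L i j \<equiv> FRel (less_sym L) [Var i, Var j]"

text \<open>The set of values of \<open>x\<close> satisfying \<open>p\<close> contains an open interval. In an o-minimal structure
  with dense order this expresses that it is infinite.\<close>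

definition int_fm ::
  "('f, 'r, 'z) og_language_scheme \<Rightarrow> nat \<Rightarrow> ('f, 'r) fm \<Rightarrow> ('f, 'r) fm" where
  "int_fm L x p = (let u = fresh (insert x (fv p)); v = Suc u in
     FEx u (FEx v (FAnd (FLess L u v)
       (FAll x (FImp (FAnd (FLess L u x) (FLess L x v)) p)))))"

lemma wf_int_fm [simp]:
  "rel_ar L (less_sym L) = 2 \<Longrightarrow> wf_fm L (int_fm L x p) \<longleftrightarrow> wf_fm L p"
  by (simp add: int_fm_def Let_def)

lemma sat_int_fm:
  "sat M e (int_fm L x p) \<longleftrightarrow>
    (\<exists>a\<in>univ M. \<exists>b\<in>univ M. less_in L M a b \<and>
      (\<forall>c\<in>univ M. less_in L M a c \<and> less_in L M c b \<longrightarrow> sat M (e(x := c)) p))"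
proof -
  define u where "u = fresh (insert x (fv p))"
  have *: "y \<in> fv p \<Longrightarrow> y < u" "x < u" for y
    by (auto simp: u_def intro: fresh_gt)
  then have "sat M (e(u := a, Suc u := b, x := c)) p \<longleftrightarrow> sat M (e(x := c)) p" for a b c
    by (intro sat_cong) (auto dest: *(1))
  moreover have "x \<noteq> u" "x \<noteq> Suc u" using *(2) by auto
  ultimately show ?thesis
    by (simp add: int_fm_def Let_def u_def[symmetric]) blast
qed


section \<open>Ultrafilters\<close>

definition ultra :: "'i filter \<Rightarrow> bool" where
  "ultra F \<longleftrightarrow> F \<noteq> bot \<and> (\<forall>P. eventually P F \<or> eventually (\<lambda>i. \<not> P i) F)"

lemma ultra_not:
  assumes F: "ultra F"
  shows "eventually (\<lambda>i. \<not> P i) F \<longleftrightarrow> \<not> eventually P F"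
proof
  assume "eventually (\<lambda>i. \<not> P i) F"
  then show "\<not> eventually P F"
    using F eventually_conj[of "\<lambda>i. \<not> P i" F P] by (auto simp: ultra_def trivial_limit_def)
qed (use F in \<open>auto simp: ultra_def\<close>)

text \<open>Zorn's lemma yields a minimal proper filter. Minimality decides every predicate: if
  restricting the filter to \<open>P\<close> leaves it proper, the restriction is the filter
  itself.\<close>

lemma ultra_exists:
  assumes "F0 \<noteq> bot"
  obtains F where "ultra F" "F \<le> F0"
proof -
  define A where "A = {F. F \<noteq> bot \<and> F \<le> F0}"
  have "\<exists>m\<in>A. \<forall>a\<in>A. a \<le> m \<longrightarrow> a = m"
  proof (rule predicate_Zorn[where P = "\<lambda>x y. y \<le> x"])
    show "partial_order_on A (relation_of (\<lambda>x y. y \<le> x) A)"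
      by (rule partial_order_on_relation_ofI) auto
    fix C assume "C \<in> Chains (relation_of (\<lambda>x y. y \<le> x) A)"
    then have C: "C \<subseteq> A" "\<And>x y. x \<in> C \<Longrightarrow> y \<in> C \<Longrightarrow> x \<le> y \<or> y \<le> x"
      by (auto simp: Chains_def relation_of_def)
    \<comment> \<open>Including \<open>F0\<close> keeps the infimum below \<open>F0\<close> even for
      the empty chain.\<close>
    let ?B = "insert F0 C"
    have "Inf X \<in> A" if "X \<noteq> {}" "X \<subseteq> ?B" "finite X" for X
    proof -
      have "finite X \<Longrightarrow> X \<noteq> {} \<Longrightarrow> X \<subseteq> ?B \<Longrightarrow> Inf X \<in> X"
      proof (induction X rule: finite_ne_induct)
        case (insert x X)
        then have "x \<in> ?B" "Inf X \<in> ?B" by auto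
        then have "x \<le> Inf X \<or> Inf X \<le> x" using C unfolding A_def by blast
        then have "inf x (Inf X) \<in> {x, Inf X}" by (auto simp: inf_absorb1 inf_absorb2)
        with insert show ?case by auto
      qed simp
      then have "Inf X \<in> ?B" using that by blast
      then show ?thesis using C(1) assms by (auto simp: A_def)
    qed
    moreover have "(top :: 'a filter) \<noteq> bot" using assms by (metis bot.extremum_uniqueI top_greatest)
    ultimately have "Inf X \<noteq> bot" if "X \<subseteq> ?B" "finite X" for X
      using that by (cases "X = {}") (auto simp: A_def)
    then have "Inf ?B \<noteq> bot" by (rule Inf_filter_not_bot)
    then have "Inf ?B \<in> A" by (simp add: A_def)
    then show "\<exists>u\<in>A. \<forall>a\<in>C. u \<le> a" by (intro bexI[of _ "Inf ?B"] ballI Inf_lower) auto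
  qed
  then obtain F where F: "F \<in> A" "\<And>G. G \<in> A \<Longrightarrow> G \<le> F \<Longrightarrow> G = F" by blast
  have "eventually P F" if "\<not> eventually (\<lambda>i. \<not> P i) F" for P
  proof -
    let ?G = "inf F (principal {i. P i})"
    have "?G \<noteq> bot"
      using that by (simp add: trivial_limit_def eventually_inf_principal)
    then have "?G = F" using F(1) by (intro F(2)) (auto simp: A_def intro: le_infI1)
    moreover have "eventually P ?G" by (simp add: eventually_inf_principal)
    ultimately show ?thesis by simp
  qed
  then have "ultra F" using F(1) unfolding ultra_def A_def by blast
  then show thesis using that F(1) unfolding A_def by blast
qed

section \<open>Skolem terms and their limits along an ultrafilter\<close>

text \<open>\<open>Gen\<close> are free generators, \<open>Btw s t\<close> stands for a point between \<open>s\<close> and \<open>t\<close>, and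
  \<open>Wit p x ts\<close> for a value of \<open>x\<close> satisfying \<open>p\<close> when \<open>ts\<close> are the values of \<open>0, 1, \<dots>\<close>.\<close>

datatype ('f, 'r) skt =
    Gen nat
  | Btw "('f, 'r) skt" "('f, 'r) skt"
  | Wit "('f, 'r) fm" nat "('f, 'r) skt list"

text \<open>Embeds Skolem terms into formulas, so that a type large enough for the formulas can also
  carry the limits. The three constructors are told apart by the outermost connective, and the end
  of an argument list by a final equation in place of a conjunction.\<close>

primrec code_skt :: "('f, 'r) skt \<Rightarrow> ('f, 'r) fm" where
  "code_skt (Gen i) = FEq (Var i) (Var i)"
| "code_skt (Btw s t) = FNot (FAnd (code_skt s) (code_skt t))"
| "code_skt (Wit p x ts) = FAnd p (FAnd (FEq (Var x) (Var x))
     (foldr FAnd (map code_skt ts) (FEq (Var 0) (Var 0))))"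

lemma foldr_FAnd_inj:
  assumes "foldr FAnd ps (FEq s t) = foldr FAnd qs (FEq s t)"
  shows "ps = qs"
  using assms
proof (induction ps arbitrary: qs)
  case Nil
  then show ?case by (cases qs) auto
next
  case (Cons p ps)
  then show ?case by (cases qs) auto
qed

lemma code_skt_eqD: "code_skt t = code_skt t' \<Longrightarrow> t = t'"
proof (induction t arbitrary: t')
  case (Gen i)
  then show ?case by (cases t') auto
next
  case (Btw s t)
  then show ?case by (cases t') auto
next
  case (Wit p x ts)
  then obtain us where t': "t' = Wit p x us" and us: "map code_skt ts = map code_skt us"
    by (cases t') (auto dest: foldr_FAnd_inj)
  have "length ts = length us" using us by (rule map_eq_imp_length_eq)
  moreover have "ts ! i = us ! i" if "i < length ts" for i
  proof (rule Wit.IH)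
    show "ts ! i \<in> set ts" using that by simp
    have "map code_skt ts ! i = map code_skt us ! i" by (simp only: us)
    then show "code_skt (ts ! i) = code_skt (us ! i)"
      using that \<open>length ts = length us\<close> by simp
  qed
  ultimately show ?case by (simp add: t' list_eq_iff_nth_eq)
qed

lemma inj_code_skt: "inj code_skt"
  by (auto intro: injI code_skt_eqD)

definition env :: "('f, 'r, 'm) interp \<Rightarrow> 'm list \<Rightarrow> nat \<Rightarrow> 'm" where
  "env M xs i = (if i < length xs then xs ! i else (SOME m. m \<in> univ M))"

definition skolem_val :: "('f, 'r, 'm) interp \<Rightarrow> (('f, 'r) skt \<Rightarrow> 'm) \<Rightarrow> bool" where
  "skolem_val M v \<longleftrightarrow> range v \<subseteq> univ M \<and>
    (\<forall>p x ts. (\<exists>c\<in>univ M. sat M ((env M (map v ts))(x := c)) p) \<longrightarrow>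
      sat M ((env M (map v ts))(x := v (Wit p x ts))) p)"

text \<open>The substructure of the ultrapower of \<open>M\<close> generated by the Skolem terms. Its elements are
  represented in the universe type by \<open>h\<close> applied to a canonical term of each class.\<close>

locale limit_struct =
  fixes L :: "('f, 'r, 'z) language_scheme"
    and M :: "('f, 'r, 'm) interp"
    and F :: "'i filter"
    and w :: "'i \<Rightarrow> ('f, 'r) skt \<Rightarrow> 'm"
    and h :: "('f, 'r) skt \<Rightarrow> 'n"
  assumes struct: "is_struct L M"
    and ultra: "ultra F"
    and skolem: "\<And>i. skolem_val M (w i)"
    and inj_h: "inj h"
begin

definition equ :: "('f, 'r) skt \<Rightarrow> ('f, 'r) skt \<Rightarrow> bool" where
  "equ s t \<longleftrightarrow> eventually (\<lambda>i. w i s = w i t) F"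

definition cl :: "('f, 'r) skt \<Rightarrow> 'n" where
  "cl t = h (SOME s. equ s t)"

definition rp :: "'n \<Rightarrow> ('f, 'r) skt" where
  "rp u = (SOME t. cl t = u)"

text \<open>Skolem terms have no constructor for the function symbols of the language. The value of
  \<open>f\<close> is named by the witness of the equation between \<open>Var n\<close> and
  \<open>f\<close> applied to the variables below \<open>n\<close>, whose solution is
  unique.\<close>

definition lim :: "('f, 'r, 'n) interp" where
  "lim = \<lparr>univ = range cl,
     fint = (\<lambda>f us. cl (let n = length us in
       Wit (FEq (Var n) (Fn f (map Var [0..<n]))) n (map rp us))),
     rint = (\<lambda>r. {us. set us \<subseteq> range cl \<and> length us = rel_ar L r \<and>
       eventually (\<lambda>i. map (\<lambda>u. w i (rp u)) us \<in> rint M r) F})\<rparr>"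

lemma univ_lim [simp]: "univ lim = range cl"
  by (simp add: lim_def)

lemma equ_refl [simp]: "equ t t"
  by (simp add: equ_def)

lemma equ_sym: "equ s t \<Longrightarrow> equ t s"
  by (simp add: equ_def eq_commute)

lemma equ_trans: "equ s t \<Longrightarrow> equ t u \<Longrightarrow> equ s u"
  unfolding equ_def by (auto elim: eventually_elim2)

lemma cl_eq_iff: "cl s = cl t \<longleftrightarrow> equ s t"
proof
  assume "cl s = cl t"
  then have "(SOME u. equ u s) = (SOME u. equ u t)"
    using inj_h by (simp add: cl_def inj_eq)
  moreover have "equ (SOME u. equ u s) s" "equ (SOME u. equ u t) t"
    by (rule someI[where P = "\<lambda>u. equ u _"], rule equ_refl)+
  ultimately show "equ s t" by (metis equ_sym equ_trans)
next
  assume "equ s t"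
  then have "(\<lambda>u. equ u s) = (\<lambda>u. equ u t)"
    by (auto simp: fun_eq_iff intro: equ_trans equ_sym)
  then show "cl s = cl t" by (simp add: cl_def)
qed

lemma cl_rp: "u \<in> range cl \<Longrightarrow> cl (rp u) = u"
  unfolding rp_def by (rule someI_ex) auto

lemma equ_rp: "equ (rp (cl t)) t"
  using cl_rp[of "cl t"] by (simp only: cl_eq_iff rangeI)

lemma w_in: "w i t \<in> univ M"
  using skolem[of i] by (auto simp: skolem_val_def)

lemma eventually_all_rp:
  "eventually (\<lambda>i. \<forall>t\<in>set ts. w i (rp (cl t)) = w i t) F"
  by (rule eventually_ball_finite) (use equ_rp in \<open>auto simp: equ_def\<close>)

lemma eventually_map_rp:
  "eventually (\<lambda>i. map (\<lambda>u. w i (rp u)) (map cl ts) = map (w i) ts) F"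
  using eventually_all_rp[of ts] by (rule eventually_mono) simp

lemma env_map_w: "x < length ts \<Longrightarrow> env M (map (w i) ts) x = w i (ts ! x)"
  by (simp add: env_def)

lemma w_Wit_fun:
  fixes us :: "('f, 'r) skt list"
  assumes "length us = fun_ar L f"
  defines "n \<equiv> length us"
  shows "w i (Wit (FEq (Var n) (Fn f (map Var [0..<n]))) n us) = fint M f (map (w i) us)"
proof -
  let ?e = "env M (map (w i) us)"
  have args: "map (eval M (?e(n := c)) \<circ> Var) [0..<n] = map (w i) us" for c
    by (rule nth_equalityI) (auto simp: n_def env_map_w)
  have "fint M f (map (w i) us) \<in> univ M"
  proof -
    have "set (map (w i) us) \<subseteq> univ M" using w_in by auto
    moreover have "length (map (w i) us) = fun_ar L f" using assms(1) by simp
    ultimately show ?thesis using struct unfolding is_struct_def by blast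
  qed
  then have "\<exists>c\<in>univ M. sat M (?e(n := c)) (FEq (Var n) (Fn f (map Var [0..<n])))"
    using args by (auto simp: fun_upd_def)
  then have "sat M (?e(n := w i (Wit (FEq (Var n) (Fn f (map Var [0..<n]))) n us)))
      (FEq (Var n) (Fn f (map Var [0..<n])))"
    using skolem[of i] unfolding skolem_val_def by blast
  then show ?thesis using args by simp
qed

lemma fint_lim:
  assumes "length ts = fun_ar L f"
  shows "\<exists>s. fint lim f (map cl ts) = cl s \<and>
    eventually (\<lambda>i. w i s = fint M f (map (w i) ts)) F"
proof -
  let ?n = "length ts" and ?us = "map (\<lambda>t. rp (cl t)) ts"
  let ?s = "Wit (FEq (Var ?n) (Fn f (map Var [0..<?n]))) ?n ?us"
  have "fint lim f (map cl ts) = cl ?s" by (simp add: lim_def comp_def Let_def)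
  moreover have w: "w i ?s = fint M f (map (\<lambda>u. w i (rp u)) (map cl ts))" for i
    using w_Wit_fun[of ?us f i] assms by (simp add: comp_def)
  have "eventually (\<lambda>i. w i ?s = fint M f (map (w i) ts)) F"
    by (rule eventually_mono[OF eventually_map_rp[of ts]]) (simp only: w)
  ultimately show ?thesis by blast
qed

lemma rint_lim:
  assumes "length ts = rel_ar L r"
  shows "map cl ts \<in> rint lim r \<longleftrightarrow> eventually (\<lambda>i. map (w i) ts \<in> rint M r) F"
proof -
  have "map cl ts \<in> rint lim r \<longleftrightarrow>
      eventually (\<lambda>i. map (\<lambda>u. w i (rp u)) (map cl ts) \<in> rint M r) F"
    using assms by (auto simp: lim_def)
  also have "\<dots> \<longleftrightarrow> eventually (\<lambda>i. map (w i) ts \<in> rint M r) F"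
    by (rule eventually_cong[OF eventually_map_rp[of ts]]) (simp only:)
  finally show ?thesis .
qed

lemma is_struct_lim: "is_struct L lim"
proof -
  have "fint lim f as \<in> range cl" for f as by (simp add: lim_def)
  then show ?thesis by (auto simp: is_struct_def) (auto simp: lim_def)
qed

lemma eval_lim:
  assumes "wf_tm L t"
  shows "\<exists>s. eval lim (\<lambda>i. cl (\<tau> i)) t = cl s \<and>
    eventually (\<lambda>i. eval M (\<lambda>j. w i (\<tau> j)) t = w i s) F"
  using assms
proof (induction t)
  case (Var x)
  then show ?case by auto
next
  case (Fn f ts)
  have "\<exists>s. eval lim (\<lambda>i. cl (\<tau> i)) t = cl s \<and>
      eventually (\<lambda>i. eval M (\<lambda>j. w i (\<tau> j)) t = w i s) F" if "t \<in> set ts" for t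
  proof -
    from Fn.prems that have "wf_tm L t" by (simp add: list_all_iff)
    from Fn.IH[OF that this] show ?thesis .
  qed
  then have "\<forall>t\<in>set ts. \<exists>s. eval lim (\<lambda>i. cl (\<tau> i)) t = cl s \<and>
      eventually (\<lambda>i. eval M (\<lambda>j. w i (\<tau> j)) t = w i s) F" by blast
  from bchoice[OF this] obtain g where
    g: "\<And>t. t \<in> set ts \<Longrightarrow> eval lim (\<lambda>i. cl (\<tau> i)) t = cl (g t)"
      "\<And>t. t \<in> set ts \<Longrightarrow> eventually (\<lambda>i. eval M (\<lambda>j. w i (\<tau> j)) t = w i (g t)) F"
    by blast
  have ev: "eventually (\<lambda>i. \<forall>t\<in>set ts. eval M (\<lambda>j. w i (\<tau> j)) t = w i (g t)) F"
    using g(2) by (simp add: eventually_ball_finite_distrib)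
  from Fn.prems fint_lim[of "map g ts" f] obtain s where
    s: "fint lim f (map cl (map g ts)) = cl s"
      "eventually (\<lambda>i. w i s = fint M f (map (w i) (map g ts))) F" by auto
  have "map (eval lim (\<lambda>i. cl (\<tau> i))) ts = map cl (map g ts)" using g(1) by simp
  then have "eval lim (\<lambda>i. cl (\<tau> i)) (Fn f ts) = cl s" using s(1) by (simp only: eval.simps)
  moreover have "eventually (\<lambda>i. eval M (\<lambda>j. w i (\<tau> j)) (Fn f ts) = w i s) F"
    using ev s(2)
  proof eventually_elim
    case (elim i)
    then have "map (eval M (\<lambda>j. w i (\<tau> j))) ts = map (w i) (map g ts)" by simp
    with elim(2) show ?case by (simp only: eval.simps)
  qed
  ultimately show ?case by blast
qed

text \<open>The theorem of Los, for a substructure of the ultrapower. Quantifiers pass because a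
  single term \<open>Wit p x ts\<close> names a witness at every index at once.\<close>

theorem sat_lim:
  assumes "wf_fm L p"
  shows "sat lim (\<lambda>j. cl (\<tau> j)) p \<longleftrightarrow> eventually (\<lambda>i. sat M (\<lambda>j. w i (\<tau> j)) p) F"
  using assms
proof (induction p arbitrary: \<tau>)
  case (FEq s t)
  then have wf: "wf_tm L s" "wf_tm L t" by auto
  obtain s' where s: "eval lim (\<lambda>i. cl (\<tau> i)) s = cl s'"
      "eventually (\<lambda>i. eval M (\<lambda>j. w i (\<tau> j)) s = w i s') F"
    using eval_lim[OF wf(1), of \<tau>] by blast
  obtain t' where t: "eval lim (\<lambda>i. cl (\<tau> i)) t = cl t'"
      "eventually (\<lambda>i. eval M (\<lambda>j. w i (\<tau> j)) t = w i t') F"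
    using eval_lim[OF wf(2), of \<tau>] by blast
  have "eventually (\<lambda>i. w i s' = w i t') F \<longleftrightarrow> eventually (\<lambda>i. sat M (\<lambda>j. w i (\<tau> j)) (FEq s t)) F"
    by (rule eventually_cong[OF eventually_conj[OF s(2) t(2)]]) auto
  then show ?case using s t by (simp add: cl_eq_iff equ_def)
next
  case (FRel r ts)
  have "\<exists>s. eval lim (\<lambda>i. cl (\<tau> i)) t = cl s \<and>
      eventually (\<lambda>i. eval M (\<lambda>j. w i (\<tau> j)) t = w i s) F" if "t \<in> set ts" for t
    using that FRel by (intro eval_lim) (auto simp: list_all_iff)
  then have "\<forall>t\<in>set ts. \<exists>s. eval lim (\<lambda>i. cl (\<tau> i)) t = cl s \<and>
      eventually (\<lambda>i. eval M (\<lambda>j. w i (\<tau> j)) t = w i s) F" by blast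
  from bchoice[OF this] obtain g where
    g: "\<And>t. t \<in> set ts \<Longrightarrow> eval lim (\<lambda>i. cl (\<tau> i)) t = cl (g t)"
      "\<And>t. t \<in> set ts \<Longrightarrow> eventually (\<lambda>i. eval M (\<lambda>j. w i (\<tau> j)) t = w i (g t)) F"
    by blast
  have ev: "eventually (\<lambda>i. \<forall>t\<in>set ts. eval M (\<lambda>j. w i (\<tau> j)) t = w i (g t)) F"
    using g(2) by (simp add: eventually_ball_finite_distrib)
  have "map (eval lim (\<lambda>i. cl (\<tau> i))) ts = map cl (map g ts)" using g(1) by simp
  then have "sat lim (\<lambda>j. cl (\<tau> j)) (FRel r ts) \<longleftrightarrow>
      eventually (\<lambda>i. map (w i) (map g ts) \<in> rint M r) F"
    using rint_lim[of "map g ts" r] FRel by (simp only: sat.simps) simp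
  also have "\<dots> \<longleftrightarrow> eventually (\<lambda>i. sat M (\<lambda>j. w i (\<tau> j)) (FRel r ts)) F"
  proof (rule eventually_cong[OF ev])
    fix i assume "\<forall>t\<in>set ts. eval M (\<lambda>j. w i (\<tau> j)) t = w i (g t)"
    then have "map (eval M (\<lambda>j. w i (\<tau> j))) ts = map (w i) (map g ts)" by simp
    then show "map (w i) (map g ts) \<in> rint M r \<longleftrightarrow> sat M (\<lambda>j. w i (\<tau> j)) (FRel r ts)"
      by (simp only: sat.simps)
  qed
  finally show ?case .
next
  case (FNot p)
  then show ?case using ultra_not[OF ultra] by simp
next
  case (FAnd p q)
  then show ?case by (simp add: eventually_conj_iff)
next
  case (FEx x p)
  have upd: "(\<lambda>j. cl (\<tau> j))(x := cl t) = (\<lambda>j. cl ((\<tau>(x := t)) j))"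
    "(\<lambda>j. w i (\<tau> j))(x := w i t) = (\<lambda>j. w i ((\<tau>(x := t)) j))" for t i
    by (auto simp: fun_eq_iff)
  have IH: "sat lim ((\<lambda>j. cl (\<tau> j))(x := cl t)) p \<longleftrightarrow>
      eventually (\<lambda>i. sat M ((\<lambda>j. w i (\<tau> j))(x := w i t)) p) F" for t
    unfolding upd using FEx.prems by (intro FEx.IH) simp
  \<comment> \<open>The argument list of \<open>Wit\<close> has to reach past all free variables of
    \<open>p\<close>; \<open>env\<close> replaces later values by a default.\<close>
  define n where "n = fresh (fv p)"
  define s where "s = Wit p x (map \<tau> [0..<n])"
  have n: "y < n" if "y \<in> fv p" for y using that by (simp add: n_def fresh_gt)
  have e: "sat M ((env M (map (w i) (map \<tau> [0..<n])))(x := c)) p \<longleftrightarrow>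
      sat M ((\<lambda>j. w i (\<tau> j))(x := c)) p" for i c
    by (rule sat_cong) (use n in \<open>auto simp: env_def\<close>)
  have s: "sat M (\<lambda>j. w i (\<tau> j)) (FEx x p) \<longleftrightarrow> sat M ((\<lambda>j. w i (\<tau> j))(x := w i s)) p" for i
    using skolem[of i] w_in unfolding skolem_val_def s_def e[symmetric] sat.simps by blast
  show ?case
  proof
    assume "sat lim (\<lambda>j. cl (\<tau> j)) (FEx x p)"
    then obtain t where "sat lim ((\<lambda>j. cl (\<tau> j))(x := cl t)) p" by auto
    then show "eventually (\<lambda>i. sat M (\<lambda>j. w i (\<tau> j)) (FEx x p)) F"
      unfolding IH by (rule eventually_mono) (use w_in in auto)
  next
    assume "eventually (\<lambda>i. sat M (\<lambda>j. w i (\<tau> j)) (FEx x p)) F"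
    then have "sat lim ((\<lambda>j. cl (\<tau> j))(x := cl s)) p" unfolding IH s .
    then show "sat lim (\<lambda>j. cl (\<tau> j)) (FEx x p)" by auto
  qed
qed

lemma is_model_lim:
  assumes "is_theory L T" "is_model L T M"
  shows "is_model L T lim"
  unfolding is_model_def
proof (intro conjI ballI is_struct_lim)
  fix p assume p: "p \<in> T"
  then have wf: "wf_fm L p" and fv: "fv p = {}" using assms(1)
    by (auto simp: is_theory_def sentence_def)
  have "sat M (\<lambda>j. w i t) p" for i t
    using assms(2) p w_in by (auto simp: is_model_def holds_def)
  then have "sat lim (\<lambda>j. cl t) p" for t using sat_lim[OF wf, of "\<lambda>_. t"] by simp
  then show "holds lim p"
    using sat_cong[of p _ "\<lambda>_. cl (Gen 0)" lim] fv by (simp add: holds_def)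
qed

end

section \<open>Definable sets in o-minimal structures\<close>

definition defset :: "('f, 'r, 'm) interp \<Rightarrow> (nat \<Rightarrow> 'm) \<Rightarrow> nat \<Rightarrow> ('f, 'r) fm \<Rightarrow> 'm set" where
  "defset M e x p = {a \<in> univ M. sat M (e(x := a)) p}"

lemma defset_cong:
  assumes "\<And>y. y \<in> fv p \<Longrightarrow> y \<noteq> x \<Longrightarrow> e y = e' y"
  shows "defset M e x p = defset M e' x p"
proof -
  have "sat M (e(x := a)) p \<longleftrightarrow> sat M (e'(x := a)) p" for a
    by (rule sat_cong) (use assms in auto)
  then show ?thesis by (simp add: defset_def)
qed

lemma range_upd: "range e \<subseteq> A \<Longrightarrow> a \<in> A \<Longrightarrow> range (e(x := a)) \<subseteq> A"
  by auto

locale omin =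
  fixes L :: "('f, 'r, 'z) og_language_scheme" and M :: "('f, 'r, 'm) interp"
  assumes o_minimal: "o_minimal_struct L M"
    and less_ar: "rel_ar L (less_sym L) = 2"
begin

abbreviation A :: "'m set" where "A \<equiv> univ M"
lemma is_struct_M: "is_struct L M"
  using o_minimal unfolding o_minimal_struct_def by (elim conjE) assumption

lemma fint_in: "length as = fun_ar L f \<Longrightarrow> set as \<subseteq> A \<Longrightarrow> fint M f as \<in> A"
  using is_struct_M unfolding is_struct_def by (elim conjE) blast

lemma eval_in: "wf_tm L t \<Longrightarrow> range e \<subseteq> A \<Longrightarrow> eval M e t \<in> A"
proof (induction t)
  case (Fn f ts)
  have "set (map (eval M e) ts) \<subseteq> A" using Fn by (auto simp: list_all_iff)
  then show ?case using Fn.prems fint_in[of "map (eval M e) ts" f] by simp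
qed auto

lemma univ_nonempty: "A \<noteq> {}"
  using is_struct_M unfolding is_struct_def by (elim conjE)

definition lt :: "'m \<Rightarrow> 'm \<Rightarrow> bool" where "lt a b \<longleftrightarrow> less_in L M a b"
definition le :: "'m \<Rightarrow> 'm \<Rightarrow> bool" where "le a b \<longleftrightarrow> a = b \<or> lt a b"

lemma lt_in: "lt a b \<Longrightarrow> a \<in> A \<and> b \<in> A"
proof -
  have *: "\<forall>r. rint M r \<subseteq> {as. length as = rel_ar L r \<and> set as \<subseteq> A}"
    using o_minimal unfolding o_minimal_struct_def is_struct_def by (elim conjE) assumption
  show "lt a b \<Longrightarrow> a \<in> A \<and> b \<in> A" using *[THEN spec, of "less_sym L"] by (auto simp: lt_def)
qed

lemma lt_irrefl: "\<not> lt a a"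
proof -
  have "\<forall>a\<in>A. \<not> lt a a"
    using o_minimal unfolding o_minimal_struct_def lt_def by (elim conjE) assumption
  then show ?thesis using lt_in by blast
qed

lemma lt_trans: "lt a b \<Longrightarrow> lt b c \<Longrightarrow> lt a c"
proof -
  have "\<forall>a\<in>A. \<forall>b\<in>A. \<forall>c\<in>A. lt a b \<and> lt b c \<longrightarrow> lt a c"
    using o_minimal unfolding o_minimal_struct_def lt_def by (elim conjE) assumption
  then show "lt a b \<Longrightarrow> lt b c \<Longrightarrow> lt a c" using lt_in by blast
qed

lemma lt_total: "a \<in> A \<Longrightarrow> b \<in> A \<Longrightarrow> lt a b \<or> a = b \<or> lt b a"
proof -
  have "\<forall>a\<in>A. \<forall>b\<in>A. lt a b \<or> a = b \<or> lt b a"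
    using o_minimal unfolding o_minimal_struct_def lt_def by (elim conjE) assumption
  then show "a \<in> A \<Longrightarrow> b \<in> A \<Longrightarrow> lt a b \<or> a = b \<or> lt b a" by blast
qed

sublocale ord: order le lt
  by unfold_locales (use lt_irrefl lt_trans in \<open>auto simp: le_def\<close>)

text \<open>O-minimality in a form that is visibly preserved by finite unions: membership in a definable
  set can only change at finitely many points.\<close>

definition changes_in :: "'m set \<Rightarrow> 'm set \<Rightarrow> bool" where
  "changes_in C D \<longleftrightarrow> (\<forall>u\<in>A. \<forall>v\<in>A. lt u v \<and> (\<forall>c\<in>C. \<not> (le u c \<and> le c v)) \<longrightarrow> (u \<in> D \<longleftrightarrow> v \<in> D))"

lemma changes_in_basic:
  assumes "D \<in> points_and_intervals L M"
  shows "\<exists>C. finite C \<and> C \<subseteq> A \<and> changes_in C D"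
proof -
  consider a where "a \<in> A" "D = {a}"
    | a b where "a \<in> A" "b \<in> A" "D = {c \<in> A. lt a c \<and> lt c b}"
    | a where "a \<in> A" "D = {c \<in> A. lt a c}"
    | b where "b \<in> A" "D = {c \<in> A. lt c b}"
    | "D = A"
    using assms unfolding points_and_intervals_def lt_def[symmetric] Un_iff mem_Collect_eq by blast
  then show ?thesis
  proof cases
    case 1
    then have "changes_in {a} D" unfolding changes_in_def le_def by blast
    with 1 show ?thesis by blast
  next
    case 2
    then have "changes_in {a, b} D"
      unfolding changes_in_def le_def using lt_trans lt_total by blast
    with 2 show ?thesis by (intro exI[of _ "{a, b}"]) auto
  next
    case 3
    then have "changes_in {a} D"
      unfolding changes_in_def le_def using lt_trans lt_total by blast
    with 3 show ?thesis by blast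
  next
    case 4
    then have "changes_in {b} D"
      unfolding changes_in_def le_def using lt_trans lt_total by blast
    with 4 show ?thesis by blast
  next
    case 5
    then have "changes_in {} D" unfolding changes_in_def by blast
    then show ?thesis by blast
  qed
qed

lemma changes_in_Un:
  assumes "changes_in C1 D1" "changes_in C2 D2"
  shows "changes_in (C1 \<union> C2) (D1 \<union> D2)"
  unfolding changes_in_def
proof (intro ballI impI)
  fix u v assume uv: "u \<in> A" "v \<in> A" "lt u v \<and> (\<forall>c\<in>C1 \<union> C2. \<not> (le u c \<and> le c v))"
  then have "u \<in> D1 \<longleftrightarrow> v \<in> D1" using assms(1) unfolding changes_in_def by blast
  moreover have "u \<in> D2 \<longleftrightarrow> v \<in> D2" using uv assms(2) unfolding changes_in_def by blast
  ultimately show "u \<in> D1 \<union> D2 \<longleftrightarrow> v \<in> D1 \<union> D2" by blast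
qed

lemma definable_changes:
  assumes "wf_fm L p" "range e \<subseteq> A"
  obtains C where "finite C" "C \<subseteq> A" "changes_in C (defset M e x p)"
proof -
  have "defset M e x p \<in> definable_sets L M"
    using assms by (auto simp: definable_sets_def defset_def)
  then obtain G where G: "finite G" "G \<subseteq> points_and_intervals L M" "defset M e x p = \<Union> G"
  proof -
    have "\<forall>D\<in>definable_sets L M. \<exists>G. finite G \<and> G \<subseteq> points_and_intervals L M \<and> D = \<Union> G"
      using o_minimal unfolding o_minimal_struct_def by (elim conjE) assumption
    then show thesis using that \<open>defset M e x p \<in> definable_sets L M\<close> by blast
  qed
  from G(1,2) have "\<exists>C. finite C \<and> C \<subseteq> A \<and> changes_in C (\<Union> G)"
  proof (induction G rule: finite_induct)
    case empty
    show ?case by (intro exI[of _ "{}"]) (simp add: changes_in_def)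
  next
    case (insert D G)
    then have "D \<in> points_and_intervals L M" by blast
    from changes_in_basic[OF this] insert obtain C1 C2 where
      "finite C1" "C1 \<subseteq> A" "changes_in C1 D" "finite C2" "C2 \<subseteq> A" "changes_in C2 (\<Union> G)"
      by blast
    moreover from this have "changes_in (C1 \<union> C2) (\<Union> (insert D G))"
      by (simp add: changes_in_Un)
    ultimately show ?case by (intro exI[of _ "C1 \<union> C2"]) auto
  qed
  then show thesis using that G(3) by auto
qed

lemma infinite_defset:
  assumes "wf_fm L p" "range e \<subseteq> A" "infinite (defset M e x p)"
  obtains u v where "u \<in> defset M e x p" "v \<in> defset M e x p" "lt u v"
    "\<And>w. w \<in> A \<Longrightarrow> lt u w \<Longrightarrow> lt w v \<Longrightarrow> w \<in> defset M e x p"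
proof -
  let ?D = "defset M e x p"
  obtain C where C: "finite C" "C \<subseteq> A" "changes_in C ?D"
    using definable_changes[OF assms(1,2)] by blast
  define f where "f d = {c \<in> C. lt c d}" for d
  have "infinite (?D - C)" using assms(3) C(1) by simp
  moreover have "finite (f ` (?D - C))"
    by (rule finite_subset[of _ "Pow C"]) (auto simp: f_def C(1))
  ultimately obtain d where "d \<in> ?D - C" and inf: "infinite {a \<in> ?D - C. f a = f d}"
    using pigeonhole_infinite by blast
  then obtain d' where d': "d' \<in> {a \<in> ?D - C. f a = f d}" "d' \<noteq> d"
    by (metis (no_types, lifting) finite.emptyI finite.insertI insertI1 infinite_super subsetI)
  have DA: "a \<in> A" if "a \<in> ?D" for a using that by (simp add: defset_def)
  from d' \<open>d \<in> ?D - C\<close> lt_total[of d d'] DA obtain u v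
    where uv: "u \<in> ?D - C" "v \<in> ?D - C" "f u = f v" "lt u v" by auto
  have "w \<in> ?D" if w: "w \<in> A" "lt u w" "lt w v" for w
  proof -
    have "\<not> (le u c \<and> le c w)" if c: "c \<in> C" for c
    proof
      assume cw: "le u c \<and> le c w"
      have "lt u c" using cw c uv(1) by (auto simp: le_def)
      moreover have "lt c v" using cw w(3) ord.le_less_trans by blast
      then have "c \<in> f u" using c uv(3) by (simp add: f_def)
      then have "lt c u" by (simp add: f_def)
      ultimately show False by order
    qed
    then have "u \<in> ?D \<longleftrightarrow> w \<in> ?D"
      using C(3) w uv DA unfolding changes_in_def by blast
    then show ?thesis using uv by blast
  qed
  then show thesis using that uv by blast
qed

end

section \<open>Dense orders: infinity as a first-order property, and local constancy\<close>

locale dense_omin = omin L M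
  for L :: "('f, 'r, 'z) og_language_scheme" and M :: "('f, 'r, 'm) interp" +
  assumes dense: "lt a b \<Longrightarrow> \<exists>c\<in>univ M. lt a c \<and> lt c b"
begin

lemma infinite_interval:
  assumes "a \<in> A" "b \<in> A" "lt a b"
  shows "infinite {c \<in> A. lt a c \<and> lt c b}"
proof
  assume fin: "finite {c \<in> A. lt a c \<and> lt c b}"
  have "a \<in> A \<Longrightarrow> lt a b \<Longrightarrow> \<exists>X\<subseteq>{c \<in> A. lt a c \<and> lt c b}. finite X \<and> card X = n" for n a
  proof (induction n arbitrary: a)
    case 0
    show ?case by (intro exI[of _ "{}"]) simp
  next
    case (Suc n)
    from dense[OF Suc.prems(2)] obtain c
      where c: "c \<in> A" "lt a c" "lt c b" by blast
    from Suc.IH[OF c(1,3)] obtain X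
      where X: "X \<subseteq> {d \<in> A. lt c d \<and> lt d b}" "finite X" "card X = n" by blast
    moreover have "c \<notin> X" using X(1) c(1) lt_irrefl by blast
    moreover have "X \<subseteq> {d \<in> A. lt a d \<and> lt d b}"
      using X(1) c Suc.prems lt_trans by blast
    ultimately show ?case using c by (intro exI[of _ "insert c X"]) auto
  qed
  from this[OF assms(1,3), of "Suc (card {c \<in> A. lt a c \<and> lt c b})"]
  obtain X where X: "X \<subseteq> {c \<in> A. lt a c \<and> lt c b}"
    "card X = Suc (card {c \<in> A. lt a c \<and> lt c b})" by blast
  with card_mono[OF fin X(1)] show False by simp
qed

lemma sat_int_fm_iff:
  "sat M e (int_fm L x p) \<longleftrightarrow>
    (\<exists>a\<in>A. \<exists>b\<in>A. lt a b \<and> {c \<in> A. lt a c \<and> lt c b} \<subseteq> defset M e x p)"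
proof -
  have "{c \<in> A. lt a c \<and> lt c b} \<subseteq> defset M e x p \<longleftrightarrow>
      (\<forall>c\<in>A. less_in L M a c \<and> less_in L M c b \<longrightarrow> sat M (e(x := c)) p)" for a b
    unfolding lt_def defset_def by blast
  then show ?thesis by (simp only: sat_int_fm lt_def)
qed

lemma infinite_iff_int_fm:
  assumes "wf_fm L p" "range e \<subseteq> A"
  shows "infinite (defset M e x p) \<longleftrightarrow> sat M e (int_fm L x p)"
proof
  assume "infinite (defset M e x p)"
  then show "sat M e (int_fm L x p)"
  proof (rule infinite_defset[OF assms])
    fix u v assume "lt u v" and "\<And>w. w \<in> A \<Longrightarrow> lt u w \<Longrightarrow> lt w v \<Longrightarrow> w \<in> defset M e x p"
    then show ?thesis unfolding sat_int_fm_iff using lt_in[of u v] by blast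
  qed
next
  assume "sat M e (int_fm L x p)"
  then obtain a b where "a \<in> A" "b \<in> A" "lt a b"
    and sub: "{c \<in> A. lt a c \<and> lt c b} \<subseteq> defset M e x p"
    unfolding sat_int_fm_iff by blast
  then have "infinite {c \<in> A. lt a c \<and> lt c b}" by (intro infinite_interval)
  then show "infinite (defset M e x p)" by (rule infinite_super[OF sub])
qed

text \<open>Finitely many neighbourhoods are intersected. The interval from \<open>u0\<close> to
  \<open>v0\<close> is carried along because \<open>exchange\<close> knows its maximum only inside
  that interval.\<close>

lemma common_nbhd:
  assumes "finite F" "y \<in> A" "u0 \<in> A" "v0 \<in> A" "lt u0 y" "lt y v0"
    and "\<And>a. a \<in> F \<Longrightarrow> \<exists>u\<in>A. \<exists>v\<in>A. lt u y \<and> lt y v \<and> (\<forall>z\<in>A. lt u z \<and> lt z v \<longrightarrow> Q a z)"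
  shows "\<exists>u\<in>A. \<exists>v\<in>A. lt u y \<and> lt y v \<and>
    (\<forall>z\<in>A. lt u z \<and> lt z v \<longrightarrow> lt u0 z \<and> lt z v0 \<and> (\<forall>a\<in>F. Q a z))"
  using assms(1,7)
proof (induction F rule: finite_induct)
  case empty
  then show ?case using assms(3-6) by blast
next
  case (insert a F)
  then obtain u1 v1 where 1: "u1 \<in> A" "v1 \<in> A" "lt u1 y" "lt y v1"
    "\<forall>z\<in>A. lt u1 z \<and> lt z v1 \<longrightarrow> lt u0 z \<and> lt z v0 \<and> (\<forall>a\<in>F. Q a z)" by auto
  from insert.prems[of a] obtain u2 v2 where 2: "u2 \<in> A" "v2 \<in> A" "lt u2 y" "lt y v2"
    "\<forall>z\<in>A. lt u2 z \<and> lt z v2 \<longrightarrow> Q a z" by auto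
  obtain u where u: "u \<in> A" "lt u y" "le u1 u" "le u2 u"
    using 1 2 lt_total[of u1 u2] unfolding le_def by blast
  obtain v where v: "v \<in> A" "lt y v" "le v v1" "le v v2"
    using 1 2 lt_total[of v1 v2] unfolding le_def by blast
  have "lt u1 z \<and> lt z v1 \<and> lt u2 z \<and> lt z v2" if "z \<in> A" "lt u z" "lt z v" for z
    using that u(3,4) v(3,4) by (intro conjI; order)
  then have "\<forall>z\<in>A. lt u z \<and> lt z v \<longrightarrow> lt u0 z \<and> lt z v0 \<and> (\<forall>b\<in>insert a F. Q b z)"
    using 1(5) 2(5) by blast
  then show ?case using u v by blast
qed

text \<open>Descent on the number of change points between \<open>u\<close> and \<open>v\<close>: by local constancy such a
  point \<open>c\<close> can be skipped on one side.\<close>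

lemma locally_constant_aux:
  assumes C: "finite C" "C \<subseteq> A" "changes_in C D"
    and y: "y \<in> A" "y' \<in> A"
    and loc: "\<And>c. c \<in> A \<Longrightarrow> le y c \<Longrightarrow> le c y' \<Longrightarrow>
      \<exists>l\<in>A. \<exists>r\<in>A. lt l c \<and> lt c r \<and> (\<forall>z\<in>A. lt l z \<and> lt z r \<longrightarrow> (z \<in> D \<longleftrightarrow> c \<in> D))"
    and uv: "u \<in> A" "v \<in> A" "le y u" "lt u v" "le v y'"
  shows "u \<in> D \<longleftrightarrow> v \<in> D"
  using uv
proof (induction "card {c \<in> C. le u c \<and> le c v}" arbitrary: u v rule: less_induct)
  case less
  show ?case
  proof (rule ccontr)
    assume neq: "\<not> ?thesis"
    then obtain c where c: "c \<in> C" "le u c" "le c v"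
      using C(3) less.prems unfolding changes_in_def by blast
    have cA: "c \<in> A" using c(1) C(2) by (rule subsetD[rotated])
    have yc: "le y c" "le c y'"
      using ord.order_trans[OF less.prems(3) c(2)] ord.order_trans[OF c(3) less.prems(5)] by auto
    from loc[OF cA yc] obtain l r where lr: "l \<in> A" "r \<in> A" "lt l c" "lt c r"
      "\<And>z. z \<in> A \<Longrightarrow> lt l z \<Longrightarrow> lt z r \<Longrightarrow> z \<in> D \<longleftrightarrow> c \<in> D" by blast
    show False
    proof (cases "c \<in> D \<longleftrightarrow> u \<in> D")
      case True
      then have "lt c v" using neq c by (auto simp: le_def)
      \<comment> \<open>By density \<open>d\<close> can be placed just beyond \<open>c\<close>,
        before both \<open>r\<close> and \<open>v\<close>; replacing \<open>u\<close> by
        \<open>d\<close> then removes \<open>c\<close> from the count.\<close>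
      obtain m where m: "m \<in> A" "lt c m" "le m r" "le m v"
        using lt_total[of r v] lr less.prems \<open>lt c v\<close> unfolding le_def by blast
      then obtain d where d: "d \<in> A" "lt c d" "lt d m" using dense by blast
      have "lt d r" "lt d v" "lt l d" "lt u d" using d m lr(3,4) c less.prems(4) by order+
      have sub: "{x \<in> C. le d x \<and> le x v} \<subset> {x \<in> C. le u x \<and> le x v}"
      proof
        show "{x \<in> C. le d x \<and> le x v} \<subseteq> {x \<in> C. le u x \<and> le x v}"
          using \<open>lt u d\<close> lt_trans unfolding le_def by blast
        have "\<not> le d c" using d(2) by order
        then show "{x \<in> C. le d x \<and> le x v} \<noteq> {x \<in> C. le u x \<and> le x v}" using c by blast
      qed
      have "d \<in> D \<longleftrightarrow> v \<in> D"
      proof (rule less.hyps)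
        show "card {x \<in> C. le d x \<and> le x v} < card {x \<in> C. le u x \<and> le x v}"
          by (rule psubset_card_mono[OF _ sub]) (use C in simp)
        show "le y d" using \<open>lt u d\<close> less.prems(3) by order
      qed (use d \<open>lt d v\<close> less.prems in simp_all)
      then show False using lr(5)[OF d(1) \<open>lt l d\<close> \<open>lt d r\<close>] True neq by blast
    next
      case False
      then have "lt u c" using False c by (auto simp: le_def)
      have cv: "c \<in> D \<longleftrightarrow> v \<in> D" using False neq by blast
      obtain m where m: "m \<in> A" "lt m c" "le l m" "le u m"
        using lt_total[of l u] lr less.prems \<open>lt u c\<close> unfolding le_def by blast
      then obtain d where d: "d \<in> A" "lt d c" "lt m d" using dense by blast
      have "lt d r" "lt u d" "lt l d" "lt d v" using d m lr(3,4) c less.prems(4) by order+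
      have sub: "{x \<in> C. le u x \<and> le x d} \<subset> {x \<in> C. le u x \<and> le x v}"
      proof
        show "{x \<in> C. le u x \<and> le x d} \<subseteq> {x \<in> C. le u x \<and> le x v}"
          using \<open>lt d v\<close> lt_trans unfolding le_def by blast
        have "\<not> le c d" using d(2) by order
        then show "{x \<in> C. le u x \<and> le x d} \<noteq> {x \<in> C. le u x \<and> le x v}" using c by blast
      qed
      have "u \<in> D \<longleftrightarrow> d \<in> D"
      proof (rule less.hyps)
        show "card {x \<in> C. le u x \<and> le x d} < card {x \<in> C. le u x \<and> le x v}"
          by (rule psubset_card_mono[OF _ sub]) (use C in simp)
        show "le d y'" using \<open>lt d v\<close> less.prems(5) by order
      qed (use d \<open>lt u d\<close> less.prems in simp_all)
      then show False using lr(5)[OF d(1) \<open>lt l d\<close> \<open>lt d r\<close>] cv neq by blast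
    qed
  qed
qed

lemma locally_constant:
  assumes "wf_fm L p" "range e \<subseteq> A" "y \<in> A" "y' \<in> A" "lt y y'"
    and "\<And>c. c \<in> A \<Longrightarrow> le y c \<Longrightarrow> le c y' \<Longrightarrow>
      \<exists>l\<in>A. \<exists>r\<in>A. lt l c \<and> lt c r \<and>
        (\<forall>z\<in>A. lt l z \<and> lt z r \<longrightarrow> (z \<in> defset M e x p \<longleftrightarrow> c \<in> defset M e x p))"
  shows "y \<in> defset M e x p \<longleftrightarrow> y' \<in> defset M e x p"
proof -
  obtain C where "finite C" "C \<subseteq> A" "changes_in C (defset M e x p)"
    using definable_changes[OF assms(1,2)] by blast
  from locally_constant_aux[OF this assms(3,4,6), of y y'] show ?thesis
    using assms(3-5) by (simp add: le_def)
qed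

end

section \<open>Exchange\<close>

text \<open>If each \<open>y\<close> has at most \<open>n\<close> values \<open>a\<close> with \<open>R(a, y)\<close>, then only finitely many \<open>a\<close> have
  infinitely many \<open>y\<close>. For let \<open>fib y\<close> be the set of all \<open>a\<close> such that \<open>R(a, _)\<close> holds near
  \<open>y\<close>. On any interval \<open>fib\<close> is constant near a point where its size is maximal, so by
  o-minimality \<open>fib\<close> is locally constant at all but finitely many points and hence takes only
  finitely many values at these. The bound \<open>n\<close> guarantees that a maximum exists.\<close>

context dense_omin
begin

lemma exchange:
  assumes p: "wf_fm L p" and xj: "x \<noteq> j" and e0: "range e0 \<subseteq> A"
    and bound: "\<And>e. range e \<subseteq> A \<Longrightarrow> finite (defset M e x p) \<and> card (defset M e x p) \<le> n"
  shows "finite (defset M e0 x (int_fm L j p))"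
proof -
  define R where "R a z \<longleftrightarrow> sat M (e0(x := a, j := z)) p" for a z
  define m where "m = fresh (insert x (insert j (fv p)))"
  \<comment> \<open>\<open>FB\<close> says that the value of \<open>x\<close> lies in
    \<open>fib\<close> of the value of \<open>m\<close>, and \<open>EF\<close> that
    \<open>fib\<close> is constant near the value of \<open>m\<close>. Thus \<open>const\<close> and
    \<open>S\<close> are definable and o-minimality applies to them.\<close>
  define FB where "FB = FEx (m+1) (FEx (m+2) (FAnd (FAnd (FLess L (m+1) m) (FLess L m (m+2)))
    (FAll j (FImp (FAnd (FLess L (m+1) j) (FLess L j (m+2))) p))))"
  define EF where "EF = FEx (m+3) (FEx (m+4) (FAnd (FAnd (FLess L (m+3) m) (FLess L m (m+4)))
    (FAll (m+5) (FImp (FAnd (FLess L (m+3) (m+5)) (FLess L (m+5) (m+4)))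
      (FAll x (FAnd (FImp FB (ident_fm (m+5) m FB)) (FImp (ident_fm (m+5) m FB) FB)))))))"
  define fib where "fib y = {a \<in> A. \<exists>u\<in>A. \<exists>v\<in>A. lt u y \<and> lt y v \<and>
    (\<forall>z\<in>A. lt u z \<and> lt z v \<longrightarrow> R a z)}" for y
  define const where "const y \<longleftrightarrow> (\<exists>u\<in>A. \<exists>v\<in>A. lt u y \<and> lt y v \<and>
    (\<forall>z\<in>A. lt u z \<and> lt z v \<longrightarrow> fib z = fib y))" for y
  define S where "S = {y \<in> A. \<not> const y}"
  have m: "x < m" "j < m" "\<And>k. k \<in> fv p \<Longrightarrow> k < m" by (simp_all add: m_def fresh_gt)
  have wf: "wf_fm L FB" "wf_fm L EF" using p less_ar by (simp_all add: FB_def EF_def)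
  have satFB: "sat M e FB \<longleftrightarrow> a \<in> fib y"
    if "e m = y" "a \<in> A" "e x = a" "\<And>k. k < m \<Longrightarrow> k \<noteq> x \<Longrightarrow> e k = e0 k" for e a y
  proof -
    have "sat M (e(m+1 := u, m+2 := v, j := z)) p \<longleftrightarrow> R a z" for u v z
      unfolding R_def by (rule sat_cong) (use m that xj in \<open>auto dest: m(3)\<close>)
    then show ?thesis
      using that(1,2) m(2) unfolding FB_def fib_def lt_def by (auto simp: imp_conjL)
  qed
  have satEF: "sat M (e0(m := y)) EF \<longleftrightarrow> const y" if y: "y \<in> A" for y
  proof -
    let ?e = "\<lambda>u v z a. (e0(m := y))(m+3 := u, m+4 := v, m+5 := z, x := a)"
    have 1: "sat M (?e u v z a) FB \<longleftrightarrow> a \<in> fib y" if "a \<in> A" for u v z a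
      by (rule satFB) (use that m in auto)
    have 2: "sat M (?e u v z a) (ident_fm (m+5) m FB) \<longleftrightarrow> a \<in> fib z"
      if "a \<in> A" "z \<in> A" for u v z a
    proof -
      have "sat M (?e u v z a) (ident_fm (m+5) m FB) \<longleftrightarrow> sat M ((?e u v z a)(m := z)) FB"
        using sat_ident_fm[of "?e u v z a" "m+5" M m FB] that m(1) by simp
      also have "\<dots> \<longleftrightarrow> a \<in> fib z"
        by (rule satFB) (use that m in auto)
      finally show ?thesis .
    qed
    have "fib z = fib y \<longleftrightarrow> (\<forall>a\<in>A. (a \<in> fib y \<longrightarrow> a \<in> fib z) \<and> (a \<in> fib z \<longrightarrow> a \<in> fib y))" for z
      unfolding fib_def by blast
    then show ?thesis
      using 1 2 unfolding const_def EF_def lt_def by (simp add: imp_conjL)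
  qed
  have def_fib: "{y \<in> A. a \<in> fib y} = defset M (e0(x := a)) m FB" if a: "a \<in> A" for a
  proof -
    have "sat M (e0(x := a, m := y)) FB \<longleftrightarrow> a \<in> fib y" if "y \<in> A" for y
      by (rule satFB) (use that a m in auto)
    then show ?thesis by (auto simp: defset_def)
  qed
  have def_S: "S = defset M e0 m (FNot EF)"
    using satEF by (auto simp: defset_def S_def)
  have fin_fib: "finite (fib y) \<and> card (fib y) \<le> n" if y: "y \<in> A" for y
  proof -
    have sub: "fib y \<subseteq> defset M (e0(j := y)) x p"
      using y xj by (auto simp: fib_def defset_def R_def fun_upd_twist)
    have "finite (defset M (e0(j := y)) x p) \<and> card (defset M (e0(j := y)) x p) \<le> n"
      by (rule bound) (use e0 y in auto)
    then show ?thesis using sub finite_subset card_mono order_trans by metis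
  qed
  have fin_S: "finite S"
  proof (rule ccontr)
    assume "infinite S"
    then have inf: "infinite (defset M e0 m (FNot EF))" by (simp add: def_S)
    from wf have "wf_fm L (FNot EF)" by simp
    then show False
    proof (rule infinite_defset[OF _ e0 inf])
      fix u0 v0 assume uv: "lt u0 v0" and "\<And>w. w \<in> A \<Longrightarrow> lt u0 w \<Longrightarrow> lt w v0 \<Longrightarrow> w \<in> defset M e0 m (FNot EF)"
      then have bad: "\<not> const w" if "w \<in> A" "lt u0 w" "lt w v0" for w
        using that unfolding def_S[symmetric] S_def by blast
      let ?P = "\<lambda>w. w \<in> A \<and> lt u0 w \<and> lt w v0"
      obtain y0 where "?P y0" using dense[OF uv] by blast
      moreover have "\<forall>w. ?P w \<longrightarrow> card (fib w) < Suc n" using fin_fib by (auto simp: le_imp_less_Suc)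
      ultimately obtain y where y: "?P y" and max: "\<And>w. ?P w \<Longrightarrow> card (fib w) \<le> card (fib y)"
        using ex_has_greatest_nat[of ?P y0 "\<lambda>w. card (fib w)" "Suc n"] by blast
      have yA: "y \<in> A" "lt u0 y" "lt y v0" using y by auto
      have "\<exists>u\<in>A. \<exists>v\<in>A. lt u y \<and> lt y v \<and>
          (\<forall>z\<in>A. lt u z \<and> lt z v \<longrightarrow> lt u0 z \<and> lt z v0 \<and> (\<forall>a\<in>fib y. R a z))"
        by (rule common_nbhd) (use fin_fib yA lt_in[OF uv] in \<open>auto simp: fib_def\<close>)
      then obtain u v where n: "u \<in> A" "v \<in> A" "lt u y" "lt y v" and
        near: "\<And>z. z \<in> A \<Longrightarrow> lt u z \<Longrightarrow> lt z v \<Longrightarrow> lt u0 z \<and> lt z v0 \<and> (\<forall>a\<in>fib y. R a z)"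
        by blast
      have "fib z = fib y" if z: "z \<in> A" "lt u z" "lt z v" for z
      proof -
        have "fib y \<subseteq> fib z"
        proof
          fix a assume a: "a \<in> fib y"
          then have "a \<in> A" by (simp add: fib_def)
          with a near n z show "a \<in> fib z" unfolding fib_def by blast
        qed
        moreover have "card (fib z) \<le> card (fib y)" by (rule max) (use near[OF z] z in blast)
        ultimately show ?thesis using card_seteq fin_fib[OF z(1)] by blast
      qed
      then have "const y" using n unfolding const_def by blast
      then show False using bad yA by blast
    qed
  qed
  \<comment> \<open>Since \<open>y\<close> and \<open>y'\<close> have the same points of
    \<open>S\<close> below them and are not in \<open>S\<close>, the closed interval from
    \<open>y\<close> to \<open>y'\<close> misses \<open>S\<close>. For each \<open>a\<close>, the
    definable set of points whose \<open>fib\<close> contains \<open>a\<close> is locally constant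
    there.\<close>
  have same: "fib y = fib y'"
    if y: "y \<in> A - S" "y' \<in> A - S" "{s \<in> S. lt s y} = {s \<in> S. lt s y'}" "lt y y'" for y y'
  proof -
    have noS: "const c" if c: "c \<in> A" "le y c" "le c y'" for c
    proof (rule ccontr)
      assume "\<not> const c"
      then have "c \<in> S" using c by (simp add: S_def)
      then have "lt c y'" using c(3) y(2) by (auto simp: le_def)
      then have "c \<in> {s \<in> S. lt s y}" using \<open>c \<in> S\<close> by (simp add: y(3))
      then show False using ord.le_less_trans[OF c(2)] lt_irrefl by blast
    qed
    have "a \<in> fib y \<longleftrightarrow> a \<in> fib y'" if a: "a \<in> A" for a
    proof -
      have "y \<in> defset M (e0(x := a)) m FB \<longleftrightarrow> y' \<in> defset M (e0(x := a)) m FB"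
      proof (rule locally_constant[OF wf(1)])
        fix c assume "c \<in> A" "le y c" "le c y'"
        from noS[OF this] show "\<exists>l\<in>A. \<exists>r\<in>A. lt l c \<and> lt c r \<and> (\<forall>z\<in>A. lt l z \<and> lt z r \<longrightarrow>
            (z \<in> defset M (e0(x := a)) m FB \<longleftrightarrow> c \<in> defset M (e0(x := a)) m FB))"
          using \<open>c \<in> A\<close> unfolding const_def def_fib[OF a, symmetric] by blast
      qed (use y a e0 in auto)
      then show ?thesis using y unfolding def_fib[OF a, symmetric] by blast
    qed
    then show ?thesis unfolding fib_def by blast
  qed
  have same': "fib y = fib y'"
    if y: "y \<in> A - S" "y' \<in> A - S" "{s \<in> S. lt s y} = {s \<in> S. lt s y'}" for y y'
    using lt_total[of y y'] same[OF y] same[OF y(2,1) y(3)[symmetric]] y by auto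
  \<comment> \<open>Off \<open>S\<close>, the value of \<open>fib\<close> depends only on the set of
    points of \<open>S\<close> below, for which there are finitely many possibilities.\<close>
  have "finite ((\<lambda>y. {s \<in> S. lt s y}) ` (A - S))"
    by (rule finite_subset[of _ "Pow S"]) (use fin_S in auto)
  moreover have "fib ` (A - S) \<subseteq> (\<lambda>B. fib (SOME y. y \<in> A - S \<and> {s \<in> S. lt s y} = B)) `
      ((\<lambda>y. {s \<in> S. lt s y}) ` (A - S))"
  proof
    fix B assume "B \<in> fib ` (A - S)"
    then obtain y where y: "y \<in> A - S" "B = fib y" by blast
    let ?y = "SOME y'. y' \<in> A - S \<and> {s \<in> S. lt s y'} = {s \<in> S. lt s y}"
    have "?y \<in> A - S \<and> {s \<in> S. lt s ?y} = {s \<in> S. lt s y}"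
      by (rule someI[of _ y]) (use y in simp)
    then have "fib ?y = B" using same' y by blast
    then show "B \<in> (\<lambda>B. fib (SOME y. y \<in> A - S \<and> {s \<in> S. lt s y} = B)) `
        ((\<lambda>y. {s \<in> S. lt s y}) ` (A - S))" using y by blast
  qed
  ultimately have "finite (fib ` (A - S))" using finite_surj by blast
  then have "finite (\<Union> (fib ` (A - S)))" using fin_fib by blast
  moreover have "defset M e0 x (int_fm L j p) \<subseteq> \<Union> (fib ` (A - S))"
  proof
    fix a assume "a \<in> defset M e0 x (int_fm L j p)"
    then have a: "a \<in> A" and "sat M (e0(x := a)) (int_fm L j p)" by (auto simp: defset_def)
    then obtain u v where uv: "u \<in> A" "v \<in> A" "lt u v"
      and sub: "{c \<in> A. lt u c \<and> lt c v} \<subseteq> defset M (e0(x := a)) j p"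
      unfolding sat_int_fm_iff by blast
    \<comment> \<open>An interval of good \<open>y\<close> for \<open>a\<close> outlasts the removal
      of the finite set \<open>S\<close>, so \<open>a\<close> lies in one of the finitely many
      finite values of \<open>fib\<close>.\<close>
    have "infinite ({c \<in> A. lt u c \<and> lt c v} - S)"
      using infinite_interval[OF uv] fin_S by simp
    then obtain y where y: "y \<in> {c \<in> A. lt u c \<and> lt c v} - S"
      using infinite_imp_nonempty by blast
    have "R a z" if "z \<in> A" "lt u z" "lt z v" for z
      using sub that by (auto simp: defset_def R_def)
    then have "a \<in> fib y" using a y uv unfolding fib_def by blast
    then show "a \<in> \<Union> (fib ` (A - S))" using y by blast
  qed
  ultimately show ?thesis by (rule finite_subset[rotated])
qed

end

section \<open>Algebraic closure of a dense set\<close>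

context dense_omin
begin

definition acl :: "'m set \<Rightarrow> 'm set" where
  "acl B = {c. \<exists>p e. wf_fm L p \<and> range e \<subseteq> B \<and> c \<in> defset M e 0 p \<and> finite (defset M e 0 p)}"

lemma acl_subset: "acl B \<subseteq> A"
  by (auto simp: acl_def defset_def)

lemma acl_any_var:
  assumes "wf_fm L p" "range e \<subseteq> B" "c \<in> defset M e x p" "finite (defset M e x p)"
  shows "c \<in> acl B"
proof -
  define \<sigma> where "\<sigma> = (id :: nat \<Rightarrow> nat)(0 := x, x := 0)"
  have "inj \<sigma>" by (auto simp: \<sigma>_def inj_def)
  have "(\<lambda>i. ((\<lambda>i. e (\<sigma> i))(0 := a)) (\<sigma> i)) = e(x := a)" for a
    by (auto simp: \<sigma>_def)
  then have "defset M (\<lambda>i. e (\<sigma> i)) 0 (ren \<sigma> p) = defset M e x p"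
    by (simp only: defset_def sat_ren[OF \<open>inj \<sigma>\<close>])
  moreover have "range (\<lambda>i. e (\<sigma> i)) \<subseteq> B" using assms(2) by auto
  ultimately show ?thesis using assms unfolding acl_def
    by (intro CollectI exI[of _ "ren \<sigma> p"] exI[of _ "\<lambda>i. e (\<sigma> i)"]) simp
qed

lemma subset_acl:
  assumes "B \<subseteq> A"
  shows "B \<subseteq> acl B"
proof
  fix b assume b: "b \<in> B"
  then have "defset M (\<lambda>_. b) 0 (FEq (Var 0) (Var 1)) = {b}"
    using assms by (auto simp: defset_def)
  then show "b \<in> acl B"
    using b by (intro acl_any_var[of "FEq (Var 0) (Var 1)" "\<lambda>_. b" B b 0]) auto
qed

text \<open>Parameters algebraic over \<open>B\<close> are eliminated one variable at a time: the value \<open>e k\<close> is one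
  of the finitely many solutions of some \<open>q\<close> over \<open>B\<close>, and the formula is restricted to those
  solutions for which it has finitely many solutions in \<open>x\<close>.\<close>

lemma acl_trans:
  assumes B: "B \<subseteq> A"
    and p: "wf_fm L p" "range e \<subseteq> acl B" "\<And>i. i \<ge> k \<Longrightarrow> e i \<in> B"
      "c \<in> defset M e x p" "finite (defset M e x p)"
  shows "c \<in> acl B"
  using p
proof (induction k arbitrary: p e)
  case 0
  then show ?case by (intro acl_any_var[of p e]) auto
next
  case (Suc k)
  show ?case
  proof (cases "x = k")
    case True
    \<comment> \<open>Position \<open>k\<close> is overwritten by the solution variable, so any
      element of \<open>B\<close> may stand there.\<close>
    define b where "b = e (Suc k)"
    have b: "b \<in> B" using Suc.prems(3)[of "Suc k"] by (simp add: b_def)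
    have "defset M (e(k := b)) x p = defset M e x p" using True by (simp add: defset_def)
    then have "c \<in> defset M (e(k := b)) x p" "finite (defset M (e(k := b)) x p)"
      using Suc.prems(4,5) by simp_all
    moreover have "(e(k := b)) i \<in> B" if "i \<ge> k" for i
      using that b Suc.prems(3)[of i] by auto
    moreover have "range (e(k := b)) \<subseteq> acl B"
      using Suc.prems(2) b subset_acl[OF B] by auto
    ultimately show ?thesis using Suc.prems(1) by (intro Suc.IH[of p "e(k := b)"])
  next
    case False
    have "e k \<in> acl B" using Suc.prems(2) by auto
    then obtain q d where q: "wf_fm L q" "range d \<subseteq> B" "e k \<in> defset M d 0 q"
      "finite (defset M d 0 q)" unfolding acl_def by blast
    define m where "m = fresh (insert x (insert k (fv p)))"
    have m: "x < m" "k < m" "\<And>i. i \<in> fv p \<Longrightarrow> i < m" by (simp_all add: m_def fresh_gt)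
    \<comment> \<open>The solution variable of \<open>q\<close> becomes \<open>k\<close>, and its
      parameters move beyond all variables of \<open>p\<close>, so that one environment can serve
      both formulas.\<close>
    define \<sigma> where "\<sigma> i = (if i = 0 then k else m + i)" for i
    have "inj \<sigma>" using m by (auto simp: \<sigma>_def inj_def)
    \<comment> \<open>The entry \<open>d 0\<close> at \<open>k\<close> is only a placeholder from
      \<open>B\<close>, since \<open>p'\<close> quantifies over \<open>k\<close>.\<close>
    define e' where "e' i = (if i = k then d 0 else if i < m then e i else d (i - m))" for i
    define p' where "p' = FEx k (FAnd (ren \<sigma> q) (FAnd p (FNot (int_fm L x p))))"
    have wf: "wf_fm L p'" using q(1) Suc.prems(1) less_ar by (simp add: p'_def)
    have dB: "d i \<in> B" for i using q(2) by auto
    have e': "range e' \<subseteq> acl B"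
      using dB subset_acl[OF B] Suc.prems(2) by (auto simp: e'_def)
    have e'B: "e' i \<in> B" if "i \<ge> k" for i
      using dB that Suc.prems(3)[of i] by (auto simp: e'_def)
    have satq: "sat M (e'(x := a, k := y)) (ren \<sigma> q) \<longleftrightarrow> sat M (d(0 := y)) q" for a y
    proof -
      have "(\<lambda>i. (e'(x := a, k := y)) (\<sigma> i)) = d(0 := y)"
        using m by (auto simp: \<sigma>_def e'_def fun_eq_iff)
      then show ?thesis by (simp only: sat_ren[OF \<open>inj \<sigma>\<close>])
    qed
    have satp: "sat M (e'(x := a, k := y)) p \<longleftrightarrow> a \<in> defset M (e(k := y)) x p"
      if "a \<in> A" for a y
    proof -
      have "sat M (e'(x := a, k := y)) p \<longleftrightarrow> sat M (e(k := y, x := a)) p"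
        by (rule sat_cong) (use m False in \<open>auto simp: e'_def\<close>)
      then show ?thesis using that by (simp add: defset_def)
    qed
    have sati: "sat M (e'(x := a, k := y)) (int_fm L x p) \<longleftrightarrow> infinite (defset M (e(k := y)) x p)"
      if "a \<in> A" "y \<in> A" for a y
    proof -
      have "defset M (e'(x := a, k := y)) x p = defset M (e(k := y)) x p"
        by (rule defset_cong) (use m in \<open>auto simp: e'_def\<close>)
      moreover have "range (e'(x := a, k := y)) \<subseteq> A" using e' acl_subset that by auto
      ultimately show ?thesis using infinite_iff_int_fm[OF Suc.prems(1), of "e'(x := a, k := y)" x] by simp
    qed
    define Y where "Y = {y \<in> defset M d 0 q. finite (defset M (e(k := y)) x p)}"
    have D: "defset M e' x p' = (\<Union>y\<in>Y. defset M (e(k := y)) x p)"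
    proof (intro set_eqI)
      fix a
      have "a \<in> defset M e' x p' \<longleftrightarrow> a \<in> A \<and> (\<exists>y\<in>A. sat M (d(0 := y)) q \<and>
          a \<in> defset M (e(k := y)) x p \<and> finite (defset M (e(k := y)) x p))"
        unfolding defset_def[of M e'] p'_def using satq satp sati by auto
      also have "\<dots> \<longleftrightarrow> a \<in> (\<Union>y\<in>Y. defset M (e(k := y)) x p)"
        unfolding Y_def defset_def[of M d] by (auto simp: defset_def[of M _ x])
      finally show "a \<in> defset M e' x p' \<longleftrightarrow> a \<in> (\<Union>y\<in>Y. defset M (e(k := y)) x p)" .
    qed
    show ?thesis
    proof (rule Suc.IH[OF wf e' e'B])
      have "e k \<in> Y" using q(3) Suc.prems(5) by (simp add: Y_def)
      then show "c \<in> defset M e' x p'" unfolding D using Suc.prems(4) by force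
      have "finite Y" using q(4) by (simp add: Y_def)
      then show "finite (defset M e' x p')" unfolding D by (auto simp: Y_def)
    qed
  qed
qed

definition acl_struct :: "'m set \<Rightarrow> ('f, 'r, 'm) interp" where
  "acl_struct B = \<lparr>univ = acl B, fint = fint M, rint = (\<lambda>r. {as \<in> rint M r. set as \<subseteq> acl B})\<rparr>"

lemma acl_struct_sel [simp]:
  "univ (acl_struct B) = acl B" "fint (acl_struct B) = fint M"
  "rint (acl_struct B) r = {as \<in> rint M r. set as \<subseteq> acl B}"
  by (simp_all add: acl_struct_def)

section \<open>Elementarity of the closure of a dense set by the Tarski-Vaught test\<close>

context
  fixes B :: "'m set"
  assumes B: "B \<subseteq> A" "B \<noteq> {}"
    and B_dense: "\<And>u v. lt u v \<Longrightarrow> \<exists>b\<in>B. lt u b \<and> lt b v"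
begin

lemma acl_witness:
  assumes p: "wf_fm L p" "range e \<subseteq> acl B" "defset M e x p \<noteq> {}"
  shows "\<exists>c\<in>acl B. c \<in> defset M e x p"
proof (cases "finite (defset M e x p)")
  case True
  obtain b where b: "b \<in> B" using B by blast
  obtain c where c: "c \<in> defset M e x p" using p by blast
  define k where "k = fresh (fv p)"
  \<comment> \<open>\<open>acl_trans\<close> eliminates only finitely many parameters, so those that
    \<open>p\<close> does not read are first replaced by \<open>b\<close>.\<close>
  define e' where "e' i = (if i < k then e i else b)" for i
  have D: "defset M e' x p = defset M e x p"
    by (rule defset_cong) (auto simp: e'_def k_def fresh_gt)
  have "range e' \<subseteq> acl B" using p(2) b subset_acl[OF B(1)] by (auto simp: e'_def)
  then have "c \<in> acl B"
    using acl_trans[OF B(1) p(1), of e' k c x] D c True b by (simp add: e'_def)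
  with c show ?thesis by blast
next
  case False
  have "range e \<subseteq> A" using p(2) acl_subset by blast
  from p(1) this False show ?thesis
  proof (rule infinite_defset)
    fix u v assume uv: "lt u v" and *: "\<And>w. w \<in> A \<Longrightarrow> lt u w \<Longrightarrow> lt w v \<Longrightarrow> w \<in> defset M e x p"
    obtain b where "b \<in> B" "lt u b" "lt b v" using B_dense[OF uv] by blast
    then show ?thesis using * subset_acl[OF B(1)] B(1) by blast
  qed
qed

text \<open>The value of the term is the only solution of an equation over \<open>acl B\<close>, so
  the witness found there must be it.\<close>

lemma acl_eval:
  assumes "wf_tm L t" "range e \<subseteq> acl B"
  shows "eval M e t \<in> acl B"
proof -
  define x where "x = fresh (vars_tm t)"
  have "eval M (e(x := c)) t = eval M e t" for c
    by (rule eval_cong) (auto simp: x_def dest: fresh_gt[rotated])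
  then have D: "defset M e x (FEq (Var x) t) = {eval M e t}"
    using eval_in[OF assms(1), of e] assms(2) acl_subset by (auto simp: defset_def)
  have "\<exists>c\<in>acl B. c \<in> defset M e x (FEq (Var x) t)"
    by (rule acl_witness) (use assms D in auto)
  then show ?thesis unfolding D by blast
qed

lemma eval_acl_struct: "eval (acl_struct B) e t = eval M e t"
proof (induction t)
  case (Fn f ts)
  then have "map (eval (acl_struct B) e) ts = map (eval M e) ts" by simp
  then show ?case by (simp only: eval.simps acl_struct_sel)
qed simp

lemma sat_acl_struct:
  "wf_fm L p \<Longrightarrow> range e \<subseteq> acl B \<Longrightarrow> sat (acl_struct B) e p \<longleftrightarrow> sat M e p"
proof (induction p arbitrary: e)
  case (FEq s t)
  show ?case by (simp add: eval_acl_struct)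
next
  case (FRel r ts)
  then have "set (map (eval M e) ts) \<subseteq> acl B"
    using acl_eval by (auto simp: list_all_iff)
  moreover have "eval (acl_struct B) e = eval M e"
    by (simp add: eval_acl_struct fun_eq_iff)
  ultimately show ?case by simp
next
  case (FEx x p)
  have IH: "sat (acl_struct B) (e(x := c)) p \<longleftrightarrow> sat M (e(x := c)) p" if "c \<in> acl B" for c
    using that FEx.prems by (intro FEx.IH) auto
  have "(\<exists>c\<in>acl B. sat M (e(x := c)) p) \<longleftrightarrow> (\<exists>c\<in>A. sat M (e(x := c)) p)"
    using acl_witness[of p e x] FEx.prems subsetD[OF acl_subset[of B]] by (auto simp: defset_def)
  then show ?case using IH by simp
qed simp_all

lemma elementary_acl: "elementary_sub L (acl_struct B) M"
  unfolding elementary_sub_def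
proof (intro conjI allI impI)
  obtain b where b: "b \<in> acl B" using B subset_acl by blast
  show "is_struct L (acl_struct B)"
    unfolding is_struct_def
  proof (intro conjI allI impI)
    show "univ (acl_struct B) \<noteq> {}" using b by auto
    fix f as assume as: "length as = fun_ar L f \<and> set as \<subseteq> univ (acl_struct B)"
    define e where "e i = (if i < length as then as ! i else b)" for i
    have "map (eval M e \<circ> Var) [0..<length as] = as"
      by (rule nth_equalityI) (auto simp: e_def)
    then have "eval M e (Fn f (map Var [0..<length as])) = fint M f as" by simp
    moreover have "eval M e (Fn f (map Var [0..<length as])) \<in> acl B"
      by (rule acl_eval) (use as b in \<open>auto simp: e_def list_all_iff\<close>)
    ultimately show "fint (acl_struct B) f as \<in> univ (acl_struct B)" by simp
  next
    fix r
    have "\<forall>r. rint M r \<subseteq> {as. length as = rel_ar L r \<and> set as \<subseteq> A}"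
      using is_struct_M unfolding is_struct_def by (elim conjE) assumption
    then show "rint (acl_struct B) r \<subseteq> {as. length as = rel_ar L r \<and> set as \<subseteq> univ (acl_struct B)}"
      by auto
  qed
  show "is_struct L M" by (rule is_struct_M)
  show "univ (acl_struct B) \<subseteq> A" using acl_subset by simp
qed (use sat_acl_struct in auto)

end

end

section \<open>Skolem valuations and uniform finiteness\<close>

text \<open>The guard makes this the whole universe when \<open>u\<close> is not below
  \<open>v\<close>. So a term \<open>Btw s t\<close> always has a value, and in an infinite dense
  structure infinitely many possible ones.\<close>

definition between :: "('f, 'r, 'z) og_language_scheme \<Rightarrow> ('f, 'r, 'm) interp \<Rightarrow> 'm \<Rightarrow> 'm \<Rightarrow> 'm set" where
  "between L M u v = {c \<in> univ M. less_in L M u v \<longrightarrow> less_in L M u c \<and> less_in L M c v}"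

text \<open>The values \<open>\<beta> s t\<close> of the terms \<open>Btw s t\<close> are free as long as they lie between those of
  \<open>s\<close> and \<open>t\<close>.\<close>

primrec val :: "('f, 'r, 'z) og_language_scheme \<Rightarrow> ('f, 'r, 'm) interp \<Rightarrow> (nat \<Rightarrow> 'm) \<Rightarrow>
    (('f, 'r) skt \<Rightarrow> ('f, 'r) skt \<Rightarrow> 'm) \<Rightarrow> ('f, 'r) skt \<Rightarrow> 'm" where
  "val L M g \<beta> (Gen i) = g i"
| "val L M g \<beta> (Btw s t) = (if \<beta> s t \<in> between L M (val L M g \<beta> s) (val L M g \<beta> t) then \<beta> s t
     else SOME c. c \<in> between L M (val L M g \<beta> s) (val L M g \<beta> t))"
| "val L M g \<beta> (Wit p x ts) = (SOME c. c \<in> univ M \<and>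
     ((\<exists>d\<in>univ M. sat M ((env M (map (val L M g \<beta>) ts))(x := d)) p) \<longrightarrow>
       sat M ((env M (map (val L M g \<beta>) ts))(x := c)) p))"

text \<open>Evaluation consults \<beta> only at \<open>Btw\<close> terms occurring inside
  \<open>r\<close>, and none of these is larger than \<open>r\<close>.\<close>

lemma val_cong:
  assumes "\<And>s' t'. size (Btw s' t') \<le> size r \<Longrightarrow> \<beta> s' t' = \<beta>' s' t'"
  shows "val L M g \<beta> r = val L M g \<beta>' r"
  using assms
proof (induction r)
  case (Btw s t)
  have "val L M g \<beta> s = val L M g \<beta>' s" "val L M g \<beta> t = val L M g \<beta>' t"
    by (rule Btw.IH, rule Btw.prems, simp)+
  moreover have "\<beta> s t = \<beta>' s t" by (rule Btw.prems) simp
  ultimately show ?case by simp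
next
  case (Wit p x ts)
  have "val L M g \<beta> t = val L M g \<beta>' t" if "t \<in> set ts" for t
  proof (rule Wit.IH[OF that], rule Wit.prems)
    fix s' t' :: "('a, 'b) skt" assume "size (Btw s' t') \<le> size t"
    moreover have "size t \<le> size_list size ts" using that by (rule size_list_estimation') simp
    ultimately show "size (Btw s' t') \<le> size (Wit p x ts)" by simp
  qed
  then have "map (val L M g \<beta>) ts = map (val L M g \<beta>') ts" by simp
  then show ?case by (simp only: val.simps)
qed simp

context dense_omin
begin

lemma between_nonempty: "u \<in> A \<Longrightarrow> \<exists>c. c \<in> between L M u v"
  using dense[of u v] unfolding between_def lt_def by blast

lemma val_Btw_in:
  assumes "val L M g \<beta> s \<in> A"
  shows "val L M g \<beta> (Btw s t) \<in> between L M (val L M g \<beta> s) (val L M g \<beta> t)"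
  using someI_ex[OF between_nonempty[OF assms, of "val L M g \<beta> t"]] by simp

lemma val_Wit:
  assumes "e = env M (map (val L M g \<beta>) ts)"
  shows "val L M g \<beta> (Wit p x ts) \<in> A"
    and "(\<exists>d\<in>A. sat M (e(x := d)) p) \<Longrightarrow> sat M (e(x := val L M g \<beta> (Wit p x ts))) p"
proof -
  have "\<exists>c. c \<in> A \<and> ((\<exists>d\<in>A. sat M (e(x := d)) p) \<longrightarrow> sat M (e(x := c)) p)"
    using univ_nonempty by blast
  from someI_ex[OF this] show "val L M g \<beta> (Wit p x ts) \<in> A"
    "(\<exists>d\<in>A. sat M (e(x := d)) p) \<Longrightarrow> sat M (e(x := val L M g \<beta> (Wit p x ts))) p"
    unfolding val.simps assms by blast+
qed

lemma val_in:
  assumes "range g \<subseteq> A"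
  shows "val L M g \<beta> t \<in> A"
proof (induction t)
  case (Gen i)
  then show ?case using assms by auto
next
  case (Btw s t)
  then show ?case using val_Btw_in[of g \<beta> s t] by (simp only: between_def mem_Collect_eq)
next
  case (Wit p x ts)
  show ?case by (rule val_Wit) simp
qed

lemma skolem_val:
  assumes "range g \<subseteq> A"
  shows "skolem_val M (val L M g \<beta>)"
  unfolding skolem_val_def
proof (intro conjI allI impI)
  show "range (val L M g \<beta>) \<subseteq> A" using val_in[OF assms] by blast
qed (rule val_Wit(2)[OF refl])

end

locale dense_omin_theory =
  fixes L :: "('f, 'r, 'z) og_language_scheme" and T :: "('f, 'r) fm set"
    and h :: "('f, 'r) skt \<Rightarrow> 'm"
  assumes is_thy: "is_theory L T"
    and inj_h: "inj h"
    and models: "\<And>M :: ('f, 'r, 'm) interp. is_model L T M \<Longrightarrow> dense_omin L M"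
begin

text \<open>Otherwise the limit along a nonprincipal ultrafilter of parameters with larger and larger
  finite solution sets has an infinite solution set without an interval.\<close>

lemma uniform_finiteness:
  fixes M :: "('f, 'r, 'm) interp"
  assumes M: "is_model L T M" and p: "wf_fm L p"
  shows "\<exists>n. \<forall>e. range e \<subseteq> univ M \<longrightarrow> finite (defset M e x p) \<longrightarrow> card (defset M e x p) \<le> n"
proof (rule ccontr)
  interpret M: dense_omin L M by (rule models[OF M])
  assume "\<not> ?thesis"
  then have "\<forall>n. \<exists>e. range e \<subseteq> univ M \<and> finite (defset M e x p) \<and> n < card (defset M e x p)"
    by (meson not_le)
  from choice[OF this] obtain e where e: "\<And>n. range (e n) \<subseteq> univ M"
    "\<And>n. finite (defset M (e n) x p)" "\<And>n. n < card (defset M (e n) x p)" by blast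
  obtain F :: "nat filter" where F: "ultra F" "F \<le> sequentially"
    using ultra_exists[of sequentially] by auto
  define w where "w n = val L M (e n) (\<lambda>_ _. undefined)" for n
  interpret lim: limit_struct L M F w h
  proof
    show "is_struct L M" by (rule M.is_struct_M)
    show "skolem_val M (w n)" for n unfolding w_def by (rule M.skolem_val) (rule e)
  qed (use F inj_h in auto)
  have model: "is_model L T lim.lim" by (rule lim.is_model_lim[OF is_thy M])
  interpret N: dense_omin L lim.lim by (rule models[OF model])
  have wGen: "w n (Gen i) = e n i" for n i by (simp add: w_def)
  define e' where "e' = (\<lambda>i. lim.cl (Gen i))"
  have e': "range e' \<subseteq> univ lim.lim" by (auto simp: e'_def)
  let ?D = "defset lim.lim e' x p"
  \<comment> \<open>Every solution set in \<open>M\<close> is finite and so contains no interval.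
    This passes to the limit, where o-minimality makes the solution set finite again.\<close>
  have "sat lim.lim e' (FNot (int_fm L x p))"
  proof -
    have "sat M (\<lambda>j. w n (Gen j)) (FNot (int_fm L x p))" for n
      using M.infinite_iff_int_fm[OF p e(1), of n x] e(2) by (simp add: wGen)
    then show ?thesis
      using lim.sat_lim[of "FNot (int_fm L x p)" Gen] p N.less_ar by (simp add: e'_def)
  qed
  then have "finite ?D" using N.infinite_iff_int_fm[OF p e', of x] by simp
  then obtain us where us: "set us = ?D" using finite_list by blast
  define ts where "ts = map lim.rp us"
  have cl_ts: "lim.cl ` set ts = ?D"
  proof -
    have "lim.cl (lim.rp u) = u" if "u \<in> ?D" for u
      using that by (intro lim.cl_rp) (simp add: defset_def)
    then show ?thesis using us by (force simp: ts_def)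
  qed
  define m where "m = fresh (insert x (fv p))"
  have m: "x < m" "\<And>i. i \<in> fv p \<Longrightarrow> i < m" by (simp_all add: m_def fresh_gt)
  define vs where "vs = map (\<lambda>i. m + i) [0..<length ts]"
  define \<tau> where "\<tau> i = (if i < m then Gen i else if i - m < length ts then ts ! (i - m) else Gen 0)" for i
  \<comment> \<open>\<open>q\<close> asks for a solution besides the values of \<open>ts\<close>,
    and in the limit \<open>ts\<close> names all solutions. It holds once \<open>n\<close> reaches
    the length of \<open>ts\<close>, as there are then more solutions than values.\<close>
  define q where "q = FEx x (differ_fm x vs p)"
  have vs: "v \<noteq> x" "v \<ge> m" "\<tau> v \<in> set ts" if "v \<in> set vs" for v
    using that m by (auto simp: vs_def \<tau>_def)
  have ts_vs: "\<exists>v\<in>set vs. \<tau> v = t" if t: "t \<in> set ts" for t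
  proof -
    obtain i where "i < length ts" "ts ! i = t" using t unfolding in_set_conv_nth by blast
    then show ?thesis by (intro bexI[of _ "m + i"]) (auto simp: vs_def \<tau>_def)
  qed
  have "sat M (\<lambda>j. w n (\<tau> j)) q" if n: "n \<ge> length ts" for n
  proof -
    have "card (w n ` set ts) \<le> card (set ts)" by (rule card_image_le) simp
    also have "\<dots> \<le> length ts" by (rule card_length)
    also have "\<dots> < card (defset M (e n) x p)" using n e(3)[of n] by simp
    finally have "\<not> defset M (e n) x p \<subseteq> w n ` set ts"
      using card_mono[of "w n ` set ts" "defset M (e n) x p"] by auto
    then obtain c where c: "c \<in> univ M" "sat M ((e n)(x := c)) p" "c \<notin> w n ` set ts"
      by (auto simp: defset_def)
    have "sat M ((\<lambda>j. w n (\<tau> j))(x := c)) p \<longleftrightarrow> sat M ((e n)(x := c)) p"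
      by (rule sat_cong) (use m wGen in \<open>auto simp: \<tau>_def\<close>)
    then show ?thesis using c vs unfolding q_def by (auto simp: sat_differ_fm)
  qed
  then have "eventually (\<lambda>n. sat M (\<lambda>j. w n (\<tau> j)) q) sequentially"
    unfolding eventually_sequentially by blast
  then have "eventually (\<lambda>n. sat M (\<lambda>j. w n (\<tau> j)) q) F" by (rule filter_leD[OF F(2)])
  moreover have "wf_fm L q" using p by (simp add: q_def)
  ultimately have "sat lim.lim (\<lambda>j. lim.cl (\<tau> j)) q" by (simp only: lim.sat_lim)
  then have "\<exists>c\<in>univ lim.lim. sat lim.lim ((\<lambda>j. lim.cl (\<tau> j))(x := c)) p \<and>
      (\<forall>v\<in>set vs. c \<noteq> lim.cl (\<tau> v))"
    unfolding q_def using vs(1) by (auto simp: sat_differ_fm)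
  then obtain c where c: "c \<in> univ lim.lim" "sat lim.lim ((\<lambda>j. lim.cl (\<tau> j))(x := c)) p"
    "\<And>v. v \<in> set vs \<Longrightarrow> c \<noteq> lim.cl (\<tau> v)" by blast
  have "sat lim.lim ((\<lambda>j. lim.cl (\<tau> j))(x := c)) p \<longleftrightarrow> sat lim.lim (e'(x := c)) p"
    by (rule sat_cong) (use m in \<open>auto simp: \<tau>_def e'_def\<close>)
  then have "c \<in> ?D" using c by (simp add: defset_def)
  then obtain t where "t \<in> set ts" "c = lim.cl t" using cl_ts by blast
  then show False using ts_vs[of t] c(3) by blast
qed

end

section \<open>Existence of dense pairs\<close>

context dense_omin
begin

definition gval :: "'m \<Rightarrow> (('f, 'r) skt \<Rightarrow> ('f, 'r) skt \<Rightarrow> 'm) \<Rightarrow> ('f, 'r) skt \<times> ('f, 'r) skt \<Rightarrow> 'm" where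
  "gval a \<beta> b = val L M (\<lambda>_. a) \<beta> (Btw (fst b) (snd b))"

text \<open>\<open>K\<close> holds the variables still read as points \<open>Btw\<close>. In the
  induction of \<open>generic_val\<close> it shrinks as these are quantified away, and they fall
  back to a default.\<close>

definition genv :: "'m \<Rightarrow> (('f, 'r) skt \<Rightarrow> ('f, 'r) skt \<Rightarrow> 'm) \<Rightarrow> nat set \<Rightarrow>
    (nat \<Rightarrow> ('f, 'r) skt \<times> ('f, 'r) skt) \<Rightarrow> nat \<Rightarrow> 'm" where
  "genv a \<beta> K \<tau> i = (if i = 0 then a else if i \<in> K then gval a \<beta> (\<tau> i) else (SOME m. m \<in> A))"

lemma gval_in: "a \<in> A \<Longrightarrow> gval a \<beta> b \<in> A"
  unfolding gval_def by (rule val_in) auto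

lemma genv_in: "a \<in> A \<Longrightarrow> range (genv a \<beta> K \<tau>) \<subseteq> A"
  by (auto simp: genv_def some_in_eq univ_nonempty intro: gval_in)

abbreviation bsize :: "('f, 'r) skt \<times> ('f, 'r) skt \<Rightarrow> nat" where
  "bsize b \<equiv> size (Btw (fst b) (snd b))"

text \<open>The value at \<open>b'\<close> reads \<beta> at \<open>b'\<close> itself and at strictly
  smaller terms. A change at another term of at least the same size goes unnoticed.\<close>

lemma gval_upd:
  assumes "bsize b' \<le> bsize (s, t)" "b' \<noteq> (s, t)"
  shows "gval a (\<beta>(s := (\<beta> s)(t := y))) b' = gval a \<beta> b'"
proof -
  let ?\<beta> = "\<beta>(s := (\<beta> s)(t := y))"
  have "val L M (\<lambda>_. a) ?\<beta> r = val L M (\<lambda>_. a) \<beta> r" if r: "size r < bsize b'" for r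
  proof (rule val_cong)
    fix s' t' :: "('f, 'r) skt" assume "size (Btw s' t') \<le> size r"
    then have "(s', t') \<noteq> (s, t)" using r assms(1) by auto
    then show "?\<beta> s' t' = \<beta> s' t'" by auto
  qed
  from this[of "fst b'"] this[of "snd b'"] assms(2) show ?thesis
    by (cases b') (auto simp: gval_def)
qed

lemma gval_upd_same:
  assumes "y \<in> between L M (val L M (\<lambda>_. a) \<beta> s) (val L M (\<lambda>_. a) \<beta> t)"
  shows "gval a (\<beta>(s := (\<beta> s)(t := y))) (s, t) = y"
proof -
  let ?\<beta> = "\<beta>(s := (\<beta> s)(t := y))"
  have "val L M (\<lambda>_. a) ?\<beta> r = val L M (\<lambda>_. a) \<beta> r" if r: "size r < bsize (s, t)" for r
  proof (rule val_cong)
    fix s' t' :: "('f, 'r) skt" assume "size (Btw s' t') \<le> size r"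
    then have "(s', t') \<noteq> (s, t)" using r by auto
    then show "?\<beta> s' t' = \<beta> s' t'" by auto
  qed
  from this[of s] this[of t] assms show ?thesis by (simp add: gval_def)
qed

lemma infinite_between:
  assumes "u \<in> A" "v \<in> A" "infinite A"
  shows "infinite (between L M u v)"
proof (cases "lt u v")
  case True
  then have "between L M u v = {c \<in> A. lt u c \<and> lt c v}" by (auto simp: between_def lt_def)
  then show ?thesis using infinite_interval[OF assms(1,2) True] by simp
next
  case False
  then have "between L M u v = A" by (auto simp: between_def lt_def)
  then show ?thesis using assms(3) by simp
qed

text \<open>Choose \<open>a\<close> first and then the values of the terms \<open>Btw s t\<close> in order of size. The last
  value \<open>y\<close> has to avoid a finite set, provided that \<open>a\<close> avoids the set of all \<open>x\<close> with
  infinitely many bad \<open>y\<close>, which is finite by exchange.\<close>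

lemma generic_val:
  assumes unif: "\<And>p. wf_fm L p \<Longrightarrow>
      \<exists>n. \<forall>e. range e \<subseteq> A \<longrightarrow> finite (defset M e 0 p) \<longrightarrow> card (defset M e 0 p) \<le> n"
    and inf: "infinite A"
    and "finite X" and "finite C"
    and "\<forall>(p, K, \<tau>)\<in>C. wf_fm L p \<and> finite K \<and> 0 \<notin> K \<and> \<tau> ` K \<subseteq> X \<and>
      (\<forall>e. range e \<subseteq> A \<longrightarrow> finite (defset M e 0 p))"
  shows "\<exists>a\<in>A. \<exists>\<beta>. \<forall>(p, K, \<tau>)\<in>C. \<not> sat M (genv a \<beta> K \<tau>) p"
  using assms(3-5)
proof (induction X arbitrary: C rule: finite_ranking_induct[where f = bsize])
  case empty
  let ?e = "\<lambda>_ :: nat. SOME m. m \<in> A"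
  have e: "range ?e \<subseteq> A" using univ_nonempty by (auto simp: some_in_eq)
  \<comment> \<open>With no terms left, each condition excludes finitely many values of
    \<open>a\<close>.\<close>
  have "finite (\<Union>(p, K, \<tau>)\<in>C. defset M ?e 0 p)"
    using empty e by fastforce
  then obtain a where a: "a \<in> A" "a \<notin> (\<Union>(p, K, \<tau>)\<in>C. defset M ?e 0 p)"
    using inf by (meson finite_subset subsetI)
  have "\<not> sat M (genv a undefined K \<tau>) p" if C: "(p, K, \<tau>) \<in> C" for p K \<tau>
  proof -
    have "K = {}" using empty C by fastforce
    then have "genv a undefined K \<tau> = ?e(0 := a)" by (auto simp: genv_def)
    moreover have "\<not> sat M (?e(0 := a)) p" using a C by (force simp: defset_def)
    ultimately show ?thesis by simp
  qed
  then show ?case using a by blast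
next
  case (insert b S)
  obtain s t where b: "b = (s, t)" by (cases b)
  \<comment> \<open>The variables in \<open>I K \<tau>\<close> all denote the last point
    \<open>b\<close> and must share one value. \<open>p1\<close> merges them into the least of them,
    and \<open>p2\<close> replaces the condition by "for infinitely many values of that variable",
    which no longer mentions \<open>b\<close>.\<close>
  define I where "I K \<tau> = {i \<in> K. \<tau> i = b}" for K :: "nat set" and \<tau> :: "nat \<Rightarrow> ('f, 'r) skt \<times> ('f, 'r) skt"
  define p1 where "p1 p K \<tau> = foldr (ident_fm (Min (I K \<tau>))) (sorted_list_of_set (I K \<tau>)) p" for p :: "('f, 'r) fm" and K \<tau>
  define p2 where "p2 p K \<tau> = (if I K \<tau> = {} then p else int_fm L (Min (I K \<tau>)) (p1 p K \<tau>))" for p K \<tau>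
  define C' where "C' = (\<lambda>(p, K, \<tau>). (p2 p K \<tau>, K - I K \<tau>, \<tau>)) ` C"
  have CD: "wf_fm L p" "finite K" "0 \<notin> K" "\<tau> ` K \<subseteq> insert b S"
    "\<And>e. range e \<subseteq> A \<Longrightarrow> finite (defset M e 0 p)" if "(p, K, \<tau>) \<in> C" for p K \<tau>
    using insert.prems(2) that by blast+
  have finI: "finite (I K \<tau>)" if "(p, K, \<tau>) \<in> C" for p K \<tau>
    using CD(2)[OF that] by (simp add: I_def)
  have Min: "Min (I K \<tau>) \<in> I K \<tau>" "Min (I K \<tau>) \<noteq> 0" if C: "(p, K, \<tau>) \<in> C" and "I K \<tau> \<noteq> {}" for p K \<tau>
  proof -
    show "Min (I K \<tau>) \<in> I K \<tau>" using Min_in[OF finI[OF C]] that by blast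
    moreover have "0 \<notin> I K \<tau>" using CD(3)[OF C] by (simp add: I_def)
    ultimately show "Min (I K \<tau>) \<noteq> 0" by metis
  qed
  have sat_p1: "sat M e (p1 p K \<tau>) \<longleftrightarrow>
      sat M (\<lambda>i. if i \<in> I K \<tau> then e (Min (I K \<tau>)) else e i) p"
    if C: "(p, K, \<tau>) \<in> C" and "range e \<subseteq> A" for p K \<tau> e
  proof -
    have "e (Min (I K \<tau>)) \<in> A" using that by auto
    then show ?thesis unfolding p1_def using finI[OF C] by (simp add: sat_foldr_ident_fm)
  qed
  have fin_p1: "finite (defset M e 0 (p1 p K \<tau>))"
    if C: "(p, K, \<tau>) \<in> C" "I K \<tau> \<noteq> {}" and e: "range e \<subseteq> A" for p K \<tau> e
  proof -
    let ?e = "\<lambda>i. if i \<in> I K \<tau> then e (Min (I K \<tau>)) else e i"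
    have "0 \<notin> I K \<tau>" using CD(3)[OF C(1)] by (simp add: I_def)
    then have upd: "(\<lambda>i. if i \<in> I K \<tau> then (e(0 := a)) (Min (I K \<tau>)) else (e(0 := a)) i) = ?e(0 := a)" for a
      using Min(2)[OF C] by auto
    have "sat M (e(0 := a)) (p1 p K \<tau>) \<longleftrightarrow> sat M (?e(0 := a)) p" if "a \<in> A" for a
      using sat_p1[OF C(1), of "e(0 := a)"] range_upd[OF e that, of 0] unfolding upd by blast
    then have "defset M e 0 (p1 p K \<tau>) = defset M ?e 0 p" by (auto simp: defset_def)
    moreover have "range ?e \<subseteq> A" using e by auto
    ultimately show ?thesis using CD(5)[OF C(1)] by simp
  qed
  have wf_p1: "wf_fm L (p1 p K \<tau>)" if C: "(p, K, \<tau>) \<in> C" for p K \<tau>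
    using CD(1)[OF C] by (simp add: p1_def)
  have "\<exists>a\<in>A. \<exists>\<beta>. \<forall>(p, K, \<tau>)\<in>C'. \<not> sat M (genv a \<beta> K \<tau>) p"
  proof (rule insert.IH)
    show "finite C'" using insert.prems(1) by (simp add: C'_def)
    have *: "wf_fm L (p2 p K \<tau>) \<and> finite (K - I K \<tau>) \<and> 0 \<notin> K - I K \<tau> \<and> \<tau> ` (K - I K \<tau>) \<subseteq> S \<and>
        (\<forall>e. range e \<subseteq> A \<longrightarrow> finite (defset M e 0 (p2 p K \<tau>)))" if C: "(p, K, \<tau>) \<in> C" for p K \<tau>
    proof (intro conjI allI impI)
      show "wf_fm L (p2 p K \<tau>)" using CD(1)[OF C] wf_p1[OF C] less_ar by (simp add: p2_def)
      show "finite (K - I K \<tau>)" "0 \<notin> K - I K \<tau>" using CD[OF C] by auto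
      show "\<tau> ` (K - I K \<tau>) \<subseteq> S" using CD(4)[OF C] by (auto simp: I_def)
      fix e :: "nat \<Rightarrow> 'm" assume e: "range e \<subseteq> A"
      show "finite (defset M e 0 (p2 p K \<tau>))"
      proof (cases "I K \<tau> = {}")
        case True
        then show ?thesis using CD(5)[OF C e] by (simp add: p2_def)
      next
        case False
        obtain n where n: "\<And>e. range e \<subseteq> A \<Longrightarrow> finite (defset M e 0 (p1 p K \<tau>)) \<Longrightarrow>
            card (defset M e 0 (p1 p K \<tau>)) \<le> n" using unif[OF wf_p1[OF C]] by blast
        have "finite (defset M e 0 (int_fm L (Min (I K \<tau>)) (p1 p K \<tau>)))"
          by (rule exchange[OF wf_p1[OF C] _ e, of 0 _ n])
            (use Min(2)[OF C False] fin_p1[OF C False] n in auto)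
        then show ?thesis using False by (simp add: p2_def)
      qed
    qed
    show "\<forall>(p, K, \<tau>)\<in>C'. wf_fm L p \<and> finite K \<and> 0 \<notin> K \<and> \<tau> ` K \<subseteq> S \<and>
        (\<forall>e. range e \<subseteq> A \<longrightarrow> finite (defset M e 0 p))"
    proof (rule ballI)
      fix c assume "c \<in> C'"
      then obtain p K \<tau> where C: "(p, K, \<tau>) \<in> C" and c: "c = (p2 p K \<tau>, K - I K \<tau>, \<tau>)"
        by (auto simp: C'_def)
      from *[OF C] show "case c of (p, K, \<tau>) \<Rightarrow> wf_fm L p \<and> finite K \<and> 0 \<notin> K \<and> \<tau> ` K \<subseteq> S \<and>
          (\<forall>e. range e \<subseteq> A \<longrightarrow> finite (defset M e 0 p))"
        unfolding c prod.case .
    qed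
  qed
  then obtain a \<beta> where a: "a \<in> A"
    and a\<beta>: "\<forall>(p, K, \<tau>)\<in>C'. \<not> sat M (genv a \<beta> K \<tau>) p" by blast
  have avoid: "\<not> sat M (genv a \<beta> (K - I K \<tau>) \<tau>) (p2 p K \<tau>)" if "(p, K, \<tau>) \<in> C" for p K \<tau>
    using bspec[OF a\<beta>, of "(p2 p K \<tau>, K - I K \<tau>, \<tau>)"] that by (force simp: C'_def)
  define bad where "bad p K \<tau> = (if I K \<tau> = {} then {}
      else defset M (genv a \<beta> (K - I K \<tau>) \<tau>) (Min (I K \<tau>)) (p1 p K \<tau>))" for p K \<tau>
  have "finite (bad p K \<tau>)" if C: "(p, K, \<tau>) \<in> C" for p K \<tau>
  proof (cases "I K \<tau> = {}")
    case False
    then have "\<not> sat M (genv a \<beta> (K - I K \<tau>) \<tau>) (int_fm L (Min (I K \<tau>)) (p1 p K \<tau>))"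
      using avoid[OF C] by (simp add: p2_def)
    then have "finite (defset M (genv a \<beta> (K - I K \<tau>) \<tau>) (Min (I K \<tau>)) (p1 p K \<tau>))"
      using infinite_iff_int_fm[OF wf_p1[OF C] genv_in[OF a]] by blast
    then show ?thesis using False by (simp add: bad_def)
  qed (simp add: bad_def)
  then have "finite (\<Union>(p, K, \<tau>)\<in>C. bad p K \<tau>)"
    using insert.prems(1) by (auto intro!: finite_UN_I)
  moreover have "infinite (between L M (val L M (\<lambda>_. a) \<beta> s) (val L M (\<lambda>_. a) \<beta> t))"
    by (rule infinite_between) (use a inf val_in in auto)
  ultimately obtain y where y: "y \<in> between L M (val L M (\<lambda>_. a) \<beta> s) (val L M (\<lambda>_. a) \<beta> t)"
    "y \<notin> (\<Union>(p, K, \<tau>)\<in>C. bad p K \<tau>)" by (meson finite_subset subsetI)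
  have yA: "y \<in> A" using y(1) by (simp add: between_def)
  define \<beta>' where "\<beta>' = \<beta>(s := (\<beta> s)(t := y))"
  have "\<not> sat M (genv a \<beta>' K \<tau>) p" if C: "(p, K, \<tau>) \<in> C" for p K \<tau>
  proof -
    have "gval a \<beta>' b' = gval a \<beta> b'" if "b' \<in> S" "b' \<noteq> b" for b'
      unfolding \<beta>'_def by (rule gval_upd) (use insert.hyps(2)[OF that(1)] that(2) b in auto)
    moreover have "gval a \<beta>' b = y" unfolding b \<beta>'_def by (rule gval_upd_same[OF y(1)])
    moreover have "\<tau> i \<in> S" if "i \<in> K" "\<tau> i \<noteq> b" for i using CD(4)[OF C] that by blast
    ultimately have g: "genv a \<beta>' K \<tau> = (\<lambda>i. if i \<in> I K \<tau> then y else genv a \<beta> (K - I K \<tau>) \<tau> i)"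
      using CD(3)[OF C] by (auto simp: genv_def I_def fun_eq_iff)
    show ?thesis
    proof (cases "I K \<tau> = {}")
      case True
      then show ?thesis using avoid[OF C] g by (simp add: p2_def)
    next
      case False
      let ?e = "(genv a \<beta> (K - I K \<tau>) \<tau>)(Min (I K \<tau>) := y)"
      have "y \<notin> bad p K \<tau>" using y(2) C by blast
      then have "\<not> sat M ?e (p1 p K \<tau>)" using False yA by (simp add: bad_def defset_def)
      moreover have "range ?e \<subseteq> A" by (rule range_upd[OF genv_in[OF a] yA])
      ultimately have "\<not> sat M (\<lambda>i. if i \<in> I K \<tau> then ?e (Min (I K \<tau>)) else ?e i) p"
        using sat_p1[OF C] by blast
      moreover have "(\<lambda>i. if i \<in> I K \<tau> then ?e (Min (I K \<tau>)) else ?e i) = genv a \<beta>' K \<tau>"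
        using Min(1)[OF C False] by (auto simp: g fun_eq_iff)
      ultimately show ?thesis by simp
    qed
  qed
  then show ?case using a by blast
qed

end

context dense_omin_theory
begin

text \<open>The second conjunct rejects everything when \<open>p\<close> has infinitely many
  solutions in variable 0. So the formula has finite fibres for all parameters, as
  \<open>generic_val\<close> demands, and agrees with \<open>p\<close> where \<open>p\<close>
  witnesses algebraicity.\<close>

abbreviation thin_fm :: "('f, 'r) fm \<Rightarrow> ('f, 'r) fm" where
  "thin_fm p \<equiv> FAnd p (FNot (int_fm L 0 p))"

definition btau :: "(nat \<Rightarrow> ('f, 'r) skt \<times> ('f, 'r) skt) \<Rightarrow> nat \<Rightarrow> ('f, 'r) skt" where
  "btau \<sigma> i = (if i = 0 then Gen 0 else Btw (fst (\<sigma> i)) (snd (\<sigma> i)))"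

text \<open>Compactness in ultrafilter form: a set \<open>Cd\<close> collects the valuations in
  which one formula fails to make \<open>a\<close> algebraic over given points.
  \<open>generic_val\<close> provides the finite intersection property, and an ultrafilter
  containing all these sets makes \<open>a\<close> non-algebraic in the limit.\<close>

lemma dense_elementary_sub:
  fixes M :: "('f, 'r, 'm) interp"
  assumes M: "is_model L T M" and inf: "infinite (univ M)"
  shows "\<exists>M' N :: ('f, 'r, 'm) interp. is_model L T M' \<and> elementary_sub L N M' \<and> univ N \<noteq> univ M' \<and>
    (\<forall>a\<in>univ M'. \<forall>b\<in>univ M'. less_in L M' a b \<longrightarrow>
      (\<exists>c\<in>univ N. less_in L M' a c \<and> less_in L M' c b))"
proof -
  interpret M: dense_omin L M by (rule models[OF M])
  define m0 where "m0 = (SOME m. m \<in> univ M)"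
  have m0: "m0 \<in> univ M" using M.univ_nonempty by (simp add: m0_def some_in_eq)
  \<comment> \<open>An index is a pair of a value for \<open>a\<close> and a choice \<beta> of the
    points; first components outside the universe are redirected to \<open>m0\<close>.\<close>
  define w where "w i = val L M (\<lambda>_. if fst i \<in> univ M then fst i else m0) (snd i)"
    for i :: "'m \<times> (('f, 'r) skt \<Rightarrow> ('f, 'r) skt \<Rightarrow> 'm)"
  define Cd where "Cd = (\<lambda>(p, \<sigma>). {i. \<not> sat M (\<lambda>j. w i (btau \<sigma> j)) (thin_fm p)})"
  define J :: "(('f, 'r) fm \<times> (nat \<Rightarrow> ('f, 'r) skt \<times> ('f, 'r) skt)) set"
    where "J = {(p, \<sigma>). wf_fm L p}"
  have thin: "finite (defset M e 0 (thin_fm p))" if "wf_fm L p" "range e \<subseteq> univ M" for e p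
  proof (cases "finite (defset M e 0 p)")
    case True
    then show ?thesis by (rule finite_subset[rotated]) (auto simp: defset_def)
  next
    case False
    have "sat M (e(0 := a)) (int_fm L 0 p)" if "a \<in> univ M" for a
      using M.infinite_iff_int_fm[OF \<open>wf_fm L p\<close> range_upd[OF \<open>range e \<subseteq> univ M\<close> that, of 0], of 0] False
      by (simp add: defset_def)
    then have "defset M e 0 (thin_fm p) = {}" by (auto simp: defset_def)
    then show ?thesis by simp
  qed
  have "(\<Inter>c\<in>X. Cd c) \<noteq> {}" if X: "X \<subseteq> J" "finite X" for X
  proof -
    define C where "C = (\<lambda>(p, \<sigma>). (thin_fm p, fv (thin_fm p) - {0}, \<sigma>)) ` X"
    define Y where "Y = (\<Union>(p, \<sigma>)\<in>X. \<sigma> ` (fv (thin_fm p) - {0}))"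
    have "finite Y" unfolding Y_def using X(2) by auto
    moreover have "finite C" using X(2) by (simp add: C_def)
    moreover have "\<forall>(p, K, \<tau>)\<in>C. wf_fm L p \<and> finite K \<and> 0 \<notin> K \<and> \<tau> ` K \<subseteq> Y \<and>
        (\<forall>e. range e \<subseteq> univ M \<longrightarrow> finite (defset M e 0 p))"
    proof
      fix c assume "c \<in> C"
      then obtain p \<sigma> where p: "(p, \<sigma>) \<in> X" and c: "c = (thin_fm p, fv (thin_fm p) - {0}, \<sigma>)"
        by (auto simp: C_def)
      have wf: "wf_fm L p" using p X(1) by (auto simp: J_def)
      have "wf_fm L (thin_fm p) \<and> finite (fv (thin_fm p) - {0}) \<and> 0 \<notin> fv (thin_fm p) - {0} \<and>
        \<sigma> ` (fv (thin_fm p) - {0}) \<subseteq> Y \<and> (\<forall>e. range e \<subseteq> univ M \<longrightarrow> finite (defset M e 0 (thin_fm p)))"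
        using wf thin[OF wf] M.less_ar p by (auto simp: Y_def)
      then show "case c of (p, K, \<tau>) \<Rightarrow> wf_fm L p \<and> finite K \<and> 0 \<notin> K \<and> \<tau> ` K \<subseteq> Y \<and>
          (\<forall>e. range e \<subseteq> univ M \<longrightarrow> finite (defset M e 0 p))"
        unfolding c prod.case .
    qed
    ultimately obtain a \<beta> where a: "a \<in> univ M"
      and a\<beta>: "\<forall>(p, K, \<tau>)\<in>C. \<not> sat M (M.genv a \<beta> K \<tau>) p"
      using M.generic_val[OF uniform_finiteness[OF M] inf] by blast
    have "(a, \<beta>) \<in> Cd c" if "c \<in> X" for c
    proof -
      obtain p \<sigma> where c: "c = (p, \<sigma>)" by (cases c)
      let ?K = "fv (thin_fm p) - {0}"
      have "(thin_fm p, ?K, \<sigma>) \<in> C" using that unfolding C_def c by force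
      then have "\<not> sat M (M.genv a \<beta> ?K \<sigma>) (thin_fm p)" using a\<beta> by blast
      moreover have "sat M (M.genv a \<beta> ?K \<sigma>) (thin_fm p) \<longleftrightarrow>
          sat M (\<lambda>j. w (a, \<beta>) (btau \<sigma> j)) (thin_fm p)"
      proof (rule sat_cong)
        fix x assume "x \<in> fv (thin_fm p)"
        then show "M.genv a \<beta> ?K \<sigma> x = w (a, \<beta>) (btau \<sigma> x)"
          using a by (simp add: M.genv_def M.gval_def w_def btau_def)
      qed
      ultimately show ?thesis unfolding Cd_def c by blast
    qed
    then show ?thesis by blast
  qed
  then have "(INF c\<in>X. principal (Cd c)) \<noteq> bot" if "X \<subseteq> J" "finite X" for X
    using that by (simp add: INF_principal_finite principal_eq_bot_iff)
  then have "(INF c\<in>J. principal (Cd c)) \<noteq> bot" by (rule INF_filter_not_bot)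
  then obtain F where F: "ultra F" "F \<le> (INF c\<in>J. principal (Cd c))"
    by (rule ultra_exists)
  have ev: "eventually (\<lambda>i. \<not> sat M (\<lambda>j. w i (btau \<sigma> j)) (thin_fm p)) F" if "wf_fm L p" for p \<sigma>
  proof -
    have "F \<le> principal (Cd (p, \<sigma>))"
      using F(2) by (rule order_trans) (rule INF_lower, use that in \<open>simp add: J_def\<close>)
    then show ?thesis by (simp add: le_principal Cd_def)
  qed
  have rng: "range (\<lambda>_ :: nat. if fst i \<in> univ M then fst i else m0) \<subseteq> univ M" for i
    using m0 by auto
  interpret lim: limit_struct L M F w h
  proof
    show "is_struct L M" by (rule M.is_struct_M)
    show "skolem_val M (w i)" for i unfolding w_def by (rule M.skolem_val[OF rng])
  qed (use F inj_h in auto)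
  have model: "is_model L T lim.lim" by (rule lim.is_model_lim[OF is_thy M])
  interpret N: dense_omin L lim.lim by (rule models[OF model])
  \<comment> \<open>Here \<open>s\<close> and \<open>t\<close> range over all terms, including those
    that involve \<open>Gen 0\<close>; therefore \<open>B\<close> is dense in the whole
    limit.\<close>
  define B where "B = range (\<lambda>(s, t). lim.cl (Btw s t))"
  have B: "B \<subseteq> univ lim.lim" "B \<noteq> {}" by (auto simp: B_def)
  have less_cl: "N.lt (lim.cl s) (lim.cl t) \<longleftrightarrow> eventually (\<lambda>i. less_in L M (w i s) (w i t)) F" for s t
    using lim.rint_lim[of "[s, t]" "less_sym L"] M.less_ar by (simp add: N.lt_def)
  have B_dense: "\<exists>b\<in>B. N.lt u b \<and> N.lt b v" if uv: "N.lt u v" for u v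
  proof -
    obtain s t where u: "u = lim.cl s" and v: "v = lim.cl t" using N.lt_in[OF uv] by auto
    have *: "less_in L M (w i s) (w i t) \<Longrightarrow>
        less_in L M (w i s) (w i (Btw s t)) \<and> less_in L M (w i (Btw s t)) (w i t)" for i
      using M.val_Btw_in[OF M.val_in[OF rng], of i "snd i" s t]
      unfolding w_def between_def by blast
    have e: "eventually (\<lambda>i. less_in L M (w i s) (w i t)) F" using uv unfolding u v less_cl .
    have "N.lt u (lim.cl (Btw s t))" "N.lt (lim.cl (Btw s t)) v"
      unfolding u v less_cl by (rule eventually_mono[OF e], use * in blast)+
    moreover have "lim.cl (Btw s t) \<in> B" by (auto simp: B_def)
    ultimately show ?thesis by blast
  qed
  have "lim.cl (Gen 0) \<notin> N.acl B"
  proof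
    assume "lim.cl (Gen 0) \<in> N.acl B"
    then obtain p e where p: "wf_fm L p" and e: "range e \<subseteq> B"
      and a: "lim.cl (Gen 0) \<in> defset lim.lim e 0 p" and fin: "finite (defset lim.lim e 0 p)"
      unfolding N.acl_def by blast
    have "\<forall>i. \<exists>b. e i = lim.cl (Btw (fst b) (snd b))"
    proof
      fix i
      have "e i \<in> B" using e by blast
      then show "\<exists>b. e i = lim.cl (Btw (fst b) (snd b))" by (force simp: B_def)
    qed
    from choice[OF this] obtain \<sigma> where \<sigma>: "\<And>i. e i = lim.cl (Btw (fst (\<sigma> i)) (snd (\<sigma> i)))" by blast
    have e0: "e(0 := lim.cl (Gen 0)) = (\<lambda>j. lim.cl (btau \<sigma> j))"
      using \<sigma> by (auto simp: btau_def)
    have "range (e(0 := lim.cl (Gen 0))) \<subseteq> univ lim.lim" using e B by auto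
    from N.infinite_iff_int_fm[OF p this, of 0] fin
    have "\<not> sat lim.lim (e(0 := lim.cl (Gen 0))) (int_fm L 0 p)" by (simp add: defset_def)
    moreover have "sat lim.lim (e(0 := lim.cl (Gen 0))) p" using a by (simp add: defset_def)
    ultimately have "sat lim.lim (\<lambda>j. lim.cl (btau \<sigma> j)) (thin_fm p)" unfolding e0 by simp
    moreover have "wf_fm L (thin_fm p)" using p M.less_ar by simp
    ultimately have "eventually (\<lambda>i. sat M (\<lambda>j. w i (btau \<sigma> j)) (thin_fm p)) F"
      using lim.sat_lim by blast
    then show False using ev[OF p, of \<sigma>] ultra_not[OF F(1)] by blast
  qed
  then have "univ (N.acl_struct B) \<noteq> univ lim.lim" by auto
  moreover have "elementary_sub L (N.acl_struct B) lim.lim"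
    using B B_dense by (rule N.elementary_acl)
  moreover have "\<exists>c\<in>univ (N.acl_struct B). less_in L lim.lim a c \<and> less_in L lim.lim c b"
    if "less_in L lim.lim a b" for a b
    using B_dense[of a b] that N.subset_acl[OF B(1)] unfolding N.lt_def by auto
  ultimately show ?thesis using model by blast
qed

end

section \<open>Ordered groups\<close>

locale omin_group = omin L M
  for L :: "('f, 'r, 'z) og_language_scheme" and M :: "('f, 'r, 'm) interp" +
  assumes og_ar: "og_arities L"
    and group_axioms: "\<And>p. p \<in> ordered_abelian_group_axioms L \<Longrightarrow> holds M p"
begin

definition add :: "'m \<Rightarrow> 'm \<Rightarrow> 'm" where "add a b = fint M (plus_sym L) [a, b]"
definition neg :: "'m \<Rightarrow> 'm" where "neg a = fint M (minus_sym L) [a]"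
definition zero :: 'm where "zero = fint M (zero_sym L) []"
definition one :: 'm where "one = fint M (one_sym L) []"

lemma closed [simp]:
  "zero \<in> A" "one \<in> A" "a \<in> A \<Longrightarrow> neg a \<in> A" "a \<in> A \<Longrightarrow> b \<in> A \<Longrightarrow> add a b \<in> A"
  unfolding add_def neg_def zero_def one_def using og_ar
  by (auto intro!: fint_in simp: og_arities_def)

lemma group_axioms_sat: "\<forall>p\<in>ordered_abelian_group_axioms L. sat M (\<lambda>_. zero) p"
  using group_axioms closed(1) by (auto simp: holds_def)

lemmas group_facts = group_axioms_sat[unfolded ordered_abelian_group_axioms_def Let_def,
  simplified, folded add_def neg_def zero_def one_def lt_def]

lemma add_assoc: "a \<in> A \<Longrightarrow> b \<in> A \<Longrightarrow> c \<in> A \<Longrightarrow> add (add a b) c = add a (add b c)"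
  using group_facts[THEN conjunct1] by blast

lemma add_comm: "a \<in> A \<Longrightarrow> b \<in> A \<Longrightarrow> add a b = add b a"
  using group_facts[THEN conjunct2, THEN conjunct1] by blast

lemma add_zero [simp]: "a \<in> A \<Longrightarrow> add a zero = a"
  using group_facts[THEN conjunct2, THEN conjunct2, THEN conjunct1] by blast

lemma add_neg [simp]: "a \<in> A \<Longrightarrow> add a (neg a) = zero"
  using group_facts[THEN conjunct2, THEN conjunct2, THEN conjunct2, THEN conjunct1] by blast

lemma lt_add: "lt a b \<Longrightarrow> c \<in> A \<Longrightarrow> lt (add a c) (add b c)"
proof -
  have "\<forall>a\<in>A. \<forall>b\<in>A. lt a b \<longrightarrow> (\<forall>c\<in>A. lt (add a c) (add b c))"
    using group_facts by (elim conjE) assumption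
  then show "lt a b \<Longrightarrow> c \<in> A \<Longrightarrow> lt (add a c) (add b c)" using lt_in by blast
qed

lemma zero_lt_one: "lt zero one"
  using group_facts by (elim conjE) assumption

lemma add_left_comm:
  assumes "a \<in> A" "b \<in> A" "c \<in> A"
  shows "add b (add a c) = add a (add b c)"
  using add_assoc[of b a c] add_assoc[of a b c] add_comm[of a b] assms by simp

lemmas add_ac = add_assoc add_comm add_left_comm

lemma zero_add [simp]: "a \<in> A \<Longrightarrow> add zero a = a"
  by (simp add: add_comm[of zero])

lemma add_neg_cancel [simp]:
  "a \<in> A \<Longrightarrow> b \<in> A \<Longrightarrow> add (add a b) (neg b) = a"
  "a \<in> A \<Longrightarrow> b \<in> A \<Longrightarrow> add (add a (neg b)) b = a"
  by (simp_all add: add_assoc add_comm[of "neg b" b])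

lemma add_right_cancel:
  assumes "a \<in> A" "b \<in> A" "c \<in> A"
  shows "add a c = add b c \<longleftrightarrow> a = b"
  using add_neg_cancel(1)[of a c] add_neg_cancel(1)[of b c] assms by metis

lemma lt_add_left: "lt a b \<Longrightarrow> c \<in> A \<Longrightarrow> lt (add c a) (add c b)"
  using lt_add[of a b c] lt_in[of a b] by (simp add: add_comm)

lemma lt_add_mono: "lt a b \<Longrightarrow> lt c d \<Longrightarrow> lt (add a c) (add b d)"
  using lt_add[of a b c] lt_add_left[of c d b] lt_in[of a b] lt_in[of c d] lt_trans by blast

primrec mul :: "nat \<Rightarrow> 'm \<Rightarrow> 'm" where
  "mul 0 a = zero"
| "mul (Suc k) a = add a (mul k a)"

lemma mul_in [simp]: "a \<in> A \<Longrightarrow> mul k a \<in> A"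
  by (induction k) auto

lemma mul_add: "a \<in> A \<Longrightarrow> mul (k + l) a = add (mul k a) (mul l a)"
  by (induction k) (simp_all add: add_assoc)

lemma mul_mono: "lt a b \<Longrightarrow> lt (mul (Suc k) a) (mul (Suc k) b)"
proof (induction k)
  case 0
  then show ?case using lt_in[of a b] by simp
next
  case (Suc k)
  then show ?case using lt_add_mono[of a b "mul (Suc k) a" "mul (Suc k) b"] by simp
qed

lemma mul_inj:
  assumes "a \<in> A" "b \<in> A" "mul (Suc k) a = mul (Suc k) b"
  shows "a = b"
  using lt_total[OF assms(1,2)] mul_mono[of a b k] mul_mono[of b a k] assms(3) lt_irrefl by metis

lemma mul_one_lt: "k < l \<Longrightarrow> lt (mul k one) (mul l one)"
proof (induction l)
  case (Suc l)
  have "lt (mul l one) (mul (Suc l) one)"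
    using lt_add[OF zero_lt_one, of "mul l one"] by simp
  moreover have "k = l \<or> lt (mul k one) (mul l one)" using Suc by (cases "k = l") auto
  ultimately show ?case using lt_trans by blast
qed simp

lemma infinite_univ: "infinite A"
proof -
  have "inj (\<lambda>k. mul k one)"
  proof (rule injI)
    fix k l assume "mul k one = mul l one"
    then show "k = l" using mul_one_lt[of k l] mul_one_lt[of l k] lt_irrefl
      by (cases k l rule: linorder_cases) auto
  qed
  then have "infinite (range (\<lambda>k. mul k one))" by (simp add: finite_image_iff)
  then show ?thesis by (rule infinite_super[rotated]) auto
qed

text \<open>If the order is not dense, then there is a least positive element \<open>d\<close>. The infinite
  definable set of all doubles then contains some \<open>u\<close> together with \<open>u + d\<close>, hence \<open>d\<close>.\<close>

lemma dense_order:
  assumes "lt a b"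
  shows "\<exists>c\<in>A. lt a c \<and> lt c b"
proof (rule ccontr)
  assume nb: "\<not> ?thesis"
  have ab: "a \<in> A" "b \<in> A" using lt_in[OF assms] by auto
  define d where "d = add b (neg a)"
  have dA: "d \<in> A" using ab by (simp add: d_def)
  have d: "lt zero d" using lt_add[OF assms, of "neg a"] ab by (simp add: d_def)
  have da: "add d a = b" using ab by (simp add: d_def)
  have least: "\<not> (lt zero c \<and> lt c d)" for c
  proof
    assume c: "lt zero c \<and> lt c d"
    have "lt a (add c a)" using lt_add[of zero c a] c ab by simp
    moreover have "lt (add c a) b" using lt_add[of c d a] c ab da by simp
    ultimately show False using nb lt_in by blast
  qed
  define p :: "('f, 'r) fm" where "p = FEx 1 (FEq (Fn (plus_sym L) [Var 1, Var 1]) (Var 0))"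
  let ?D = "defset M (\<lambda>_. zero) 0 p"
  have p: "wf_fm L p" using og_ar by (simp add: p_def og_arities_def)
  have D: "?D = (\<lambda>x. add x x) ` A"
    unfolding defset_def p_def using closed(4) by (auto simp: add_def[symmetric])
  have "inj_on (\<lambda>x. add x x) A"
  proof (rule inj_onI)
    fix x y assume "x \<in> A" "y \<in> A" "add x x = add y y"
    then show "x = y" using lt_total[of x y] lt_add_mono[of x y x y] lt_add_mono[of y x y x] lt_irrefl by auto
  qed
  then have inf: "infinite ?D" unfolding D using infinite_univ finite_imageD by blast
  show False
  proof (rule infinite_defset[OF p _ inf])
    show "range (\<lambda>_ :: nat. zero) \<subseteq> A" by auto
    fix u v assume u: "u \<in> ?D" and v: "v \<in> ?D" and uv: "lt u v"
      and btw: "\<And>w. w \<in> A \<Longrightarrow> lt u w \<Longrightarrow> lt w v \<Longrightarrow> w \<in> ?D"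
    have A: "u \<in> A" "v \<in> A" using lt_in[OF uv] by auto
    have ud: "lt u (add d u)" using lt_add[OF d A(1)] A by simp
    have "\<not> lt v (add d u)"
    proof
      assume "lt v (add d u)"
      then have "lt (add v (neg u)) d" using lt_add[of v "add d u" "neg u"] A dA by simp
      moreover have "lt zero (add v (neg u))" using lt_add[OF uv, of "neg u"] A by simp
      ultimately show False using least by blast
    qed
    \<comment> \<open>The difference of \<open>v\<close> and \<open>u\<close> is at least
      \<open>d\<close>, so \<open>u + d\<close> is either the endpoint \<open>v\<close> or inside
      the interval, and a double in both cases.\<close>
    then have "add d u = v \<or> lt (add d u) v" using lt_total[of "add d u" v] A dA by auto
    then have "add d u \<in> ?D" using btw[of "add d u"] v ud A dA by auto
    then obtain y z where y: "y \<in> A" "u = add y y" and z: "z \<in> A" "add d u = add z z"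
      using u unfolding D by blast
    \<comment> \<open>Half of \<open>d\<close>, and thus a positive element below the least
      one.\<close>
    define w where "w = add z (neg y)"
    have wA: "w \<in> A" using y z by (simp add: w_def)
    have wy: "add w y = z" using y z by (simp add: w_def)
    have "add (add w w) (add y y) = add (add w y) (add w y)"
      using wA y(1) by (simp add: add_ac)
    also have "\<dots> = add d (add y y)" using z(2) y(2) wy by simp
    finally have ww: "add w w = d" using add_right_cancel[of "add w w" d "add y y"] wA y(1) dA by simp
    have "lt zero w"
      using lt_total[of zero w] lt_add_mono[of w zero w zero] wA ww d lt_trans lt_irrefl by auto
    moreover from this have "lt w d" using lt_add[of zero w w] wA ww by simp
    ultimately show False using least by blast
  qed
qed

sublocale dense_omin L M
  by unfold_locales (rule dense_order)

end


section \<open>The pattern\<close>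

primrec mul_tm :: "('f, 'r, 'z) og_language_scheme \<Rightarrow> nat \<Rightarrow> 'f tm" where
  "mul_tm L 0 = Fn (zero_sym L) []"
| "mul_tm L (Suc k) = Fn (plus_sym L) [Var 1, mul_tm L k]"

lemma wf_mul_tm: "og_arities L \<Longrightarrow> wf_tm L (mul_tm L k)"
  by (induction k) (simp_all add: og_arities_def)

lemma (in omin_group) eval_mul_tm: "eval M e (mul_tm L k) = mul k (e 1)"
  by (induction k) (simp_all add: zero_def add_def)

section \<open>Cosets of the small model and the forbidden configuration\<close>

locale omin_pair = omin_group L M
  for L :: "('f, 'r, 'z) og_language_scheme" and M :: "('f, 'r, 'm) interp" +
  fixes N :: "('f, 'r, 'm) interp"
  assumes elem: "elementary_sub L N M"
    and proper: "univ N \<noteq> univ M"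
    and N_dense: "\<And>a b. lt a b \<Longrightarrow> \<exists>c\<in>univ N. lt a c \<and> lt c b"
begin

lemma N_sub: "univ N \<subseteq> A"
  using elem unfolding elementary_sub_def by (elim conjE)

lemma N_fint:
  assumes "length as = fun_ar L f" "set as \<subseteq> univ N"
  shows "fint M f as \<in> univ N"
proof -
  have "\<forall>f as. length as = fun_ar L f \<and> set as \<subseteq> univ N \<longrightarrow> fint N f as = fint M f as"
    using elem unfolding elementary_sub_def by (elim conjE)
  then have "fint N f as = fint M f as" using assms by blast
  moreover have "is_struct L N"
    using elem unfolding elementary_sub_def by (elim conjE)
  then have "fint N f as \<in> univ N"
    using assms unfolding is_struct_def by (elim conjE) blast
  ultimately show ?thesis by simp
qed

lemma N_closed: "a \<in> univ N \<Longrightarrow> neg a \<in> univ N" "a \<in> univ N \<Longrightarrow> b \<in> univ N \<Longrightarrow> add a b \<in> univ N"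
  unfolding add_def neg_def using og_ar by (auto intro!: N_fint simp: og_arities_def)

lemma N_sat:
  assumes "wf_fm L p" "range e \<subseteq> univ N"
  shows "sat N e p \<longleftrightarrow> sat M e p"
proof -
  have "\<forall>p e. wf_fm L p \<and> range e \<subseteq> univ N \<longrightarrow> (sat N e p \<longleftrightarrow> sat M e p)"
    using elem unfolding elementary_sub_def by (elim conjE)
  with assms show ?thesis by blast
qed

text \<open>The quotient of \<open>M\<close> by \<open>N\<close> is torsion-free.\<close>

lemma N_div:
  assumes a: "a \<in> A" and n: "mul (Suc k) a \<in> univ N"
  shows "a \<in> univ N"
proof -
  let ?n = "mul (Suc k) a"
  let ?p = "FEq (mul_tm L (Suc k)) (Var 0)"
  have wf: "wf_fm L ?p" using wf_mul_tm[OF og_ar, of "Suc k"] by simp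
  \<comment> \<open>Divisibility of \<open>?n\<close> by \<open>Suc k\<close> is first-order, so
    \<open>N\<close> contains a quotient; by \<open>mul_inj\<close> it can only be
    \<open>a\<close>.\<close>
  have "sat M (\<lambda>_. ?n) (FEx 1 ?p)"
    using a eval_mul_tm[of "(\<lambda>_. ?n)(1 := a)" "Suc k"] by (auto simp del: mul_tm.simps mul.simps)
  then have "sat N (\<lambda>_. ?n) (FEx 1 ?p)"
    using N_sat[of "FEx 1 ?p" "\<lambda>_. ?n"] wf n by auto
  then obtain b where b: "b \<in> univ N" "sat N ((\<lambda>_. ?n)(1 := b)) ?p" by auto
  then have "sat M ((\<lambda>_. ?n)(1 := b)) ?p" using N_sat[OF wf, of "(\<lambda>_. ?n)(1 := b)"] n by auto
  then have "mul (Suc k) b = ?n"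
    using eval_mul_tm[of "(\<lambda>_. ?n)(1 := b)" "Suc k"] by (simp del: mul_tm.simps mul.simps)
  then show ?thesis using mul_inj[of b a k] b(1) N_sub a by auto
qed

text \<open>Otherwise a positive multiple of \<open>a\<close> would be a difference of two elements
  of \<open>N\<close>, against \<open>N_div\<close>. Multipliers are natural numbers, so the larger
  of \<open>j\<close> and \<open>l\<close> decides the sign.\<close>

lemma N_cosets:
  assumes a: "a \<in> A" "a \<notin> univ N" and c: "c \<in> univ N"
    and l: "add (add c (mul j a)) (neg (mul l a)) \<in> univ N"
  shows "l = j"
proof (rule ccontr)
  assume "l \<noteq> j"
  define n where "n = add (add c (mul j a)) (neg (mul l a))"
  have n: "n \<in> univ N" "n \<in> A" "c \<in> A" using l c N_sub by (auto simp: n_def)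
  have eq: "add c (mul j a) = add n (mul l a)" using n(3) a(1) by (simp add: n_def)
  consider k where "j = Suc k + l" | k where "l = Suc k + j"
    using \<open>l \<noteq> j\<close> less_imp_Suc_add[of l j] less_imp_Suc_add[of j l]
    by (metis add.commute add_Suc linorder_neqE_nat)
  then show False
  proof cases
    case 1
    have "add (add c (mul (Suc k) a)) (mul l a) = add n (mul l a)"
      using eq n(3) a(1) by (simp add: 1 mul_add add_assoc del: add_Suc mul.simps)
    then have "add c (mul (Suc k) a) = n"
      using add_right_cancel[of "add c (mul (Suc k) a)" n "mul l a"] n(2,3) a(1) by (simp del: mul.simps)
    then have "mul (Suc k) a = add n (neg c)"
      using add_neg_cancel(1)[of "mul (Suc k) a" c] n(3) a(1) add_comm[of c "mul (Suc k) a"]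
      by (simp del: mul.simps add_neg_cancel)
    then show False using N_div[OF a(1), of k] N_closed n(1) c a(2) by (simp del: mul.simps)
  next
    case 2
    have "add (add n (mul (Suc k) a)) (mul j a) = add c (mul j a)"
      using eq n(2) a(1) by (simp add: 2 mul_add add_assoc del: add_Suc mul.simps)
    then have "add n (mul (Suc k) a) = c"
      using add_right_cancel[of "add n (mul (Suc k) a)" c "mul j a"] n(2,3) a(1) by (simp del: mul.simps)
    then have "mul (Suc k) a = add c (neg n)"
      using add_neg_cancel(1)[of "mul (Suc k) a" n] n(2) a(1) add_comm[of n "mul (Suc k) a"]
      by (simp del: mul.simps add_neg_cancel)
    then show False using N_div[OF a(1), of k] N_closed n(1) c a(2) by (simp del: mul.simps)
  qed
qed

definition pair :: "('f, 'r pair_rel, 'm) interp" where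
  "pair = \<lparr>univ = A, fint = fint M,
     rint = (\<lambda>s. case s of Base r \<Rightarrow> rint M r | U \<Rightarrow> {[c] | c. c \<in> univ N})\<rparr>"

lemma reduct_pair: "reduct pair = M"
  by (simp add: reduct_def pair_def)

lemma is_struct_pair: "is_struct (pair_language L) pair"
proof -
  have "\<forall>r. rint M r \<subseteq> {as. length as = rel_ar L r \<and> set as \<subseteq> A}"
    using is_struct_M unfolding is_struct_def by (elim conjE)
  then have "rint pair s \<subseteq> {as. length as = rel_ar (pair_language L) s \<and> set as \<subseteq> A}" for s
    using N_sub by (cases s) (auto simp: pair_def pair_language_def)
  then show ?thesis
    using univ_nonempty fint_in by (auto simp: is_struct_def pair_def pair_language_def)
qed

lemma dense_pair_pair: "is_model L T M \<Longrightarrow> dense_pair L T pair"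
  unfolding dense_pair_def reduct_pair
  using is_struct_pair elem proper N_sub N_dense
  by (intro conjI exI[of _ N]) (auto simp: pair_def lt_def)

lemma not_dp_minimal:
  assumes "is_model (pair_language L) T' pair"
  shows "\<not> dp_minimal TYPE('m) (pair_language L) T'"
proof
  assume dp: "dp_minimal TYPE('m) (pair_language L) T'"
  obtain x where x: "x \<in> A" "x \<notin> univ N" using proper N_sub by blast
  define p :: "('f, 'r pair_rel) fm" where
    "p = FAnd (FRel (Base (less_sym L)) [Var 1, Var 0]) (FRel (Base (less_sym L)) [Var 0, Var 2])"
  define q :: "('f, 'r pair_rel) fm" where
    "q = FRel U [Fn (plus_sym L) [Var 0, Fn (minus_sym L) [Var 1]]]"
  define a where "a i = [mul i one, mul (Suc i) one]" for i
  \<comment> \<open>The entry is doubled to give both families of parameters the common length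
    2.\<close>
  define b where "b j = [mul j x, mul j x]" for j
  have p: "sat pair ((!) (c # a i)) p \<longleftrightarrow> lt (mul i one) c \<and> lt c (mul (Suc i) one)" for c i
    by (simp add: p_def a_def pair_def lt_def)
  have q: "sat pair ((!) (c # b j)) q \<longleftrightarrow> add c (neg (mul j x)) \<in> univ N" for c j
    by (simp add: q_def b_def pair_def add_def neg_def)
  have "\<exists>c\<in>univ pair. sat pair ((!) (c # a i)) p \<and> sat pair ((!) (c # b j)) q \<and>
      (\<forall>k. k \<noteq> i \<longrightarrow> \<not> sat pair ((!) (c # a k)) p) \<and>
      (\<forall>l. l \<noteq> j \<longrightarrow> \<not> sat pair ((!) (c # b l)) q)" for i j
  proof -
    \<comment> \<open>The unit interval is shifted back by \<open>mul j x\<close>, a point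
      \<open>d\<close> of \<open>N\<close> is taken there, and shifting forward again puts
      \<open>c\<close> into both the interval and the coset.\<close>
    have "lt (mul i one) (mul (Suc i) one)" by (rule mul_one_lt) simp
    then have "lt (add (mul i one) (neg (mul j x))) (add (mul (Suc i) one) (neg (mul j x)))"
      using x by (intro lt_add) auto
    from N_dense[OF this] obtain d where d: "d \<in> univ N"
      "lt (add (mul i one) (neg (mul j x))) d" "lt d (add (mul (Suc i) one) (neg (mul j x)))" by blast
    have dA: "d \<in> A" using d N_sub by blast
    define c where "c = add d (mul j x)"
    have cA: "c \<in> A" using dA x by (simp add: c_def)
    have c: "lt (mul i one) c" "lt c (mul (Suc i) one)"
      using lt_add[OF d(2), of "mul j x"] lt_add[OF d(3), of "mul j x"] x by (simp_all add: c_def)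
    have "\<not> (lt (mul k one) c \<and> lt c (mul (Suc k) one))" if "k \<noteq> i" for k
    proof
      assume k: "lt (mul k one) c \<and> lt c (mul (Suc k) one)"
      have "lt (mul k one) (mul (Suc i) one)" "lt (mul i one) (mul (Suc k) one)"
        using c k lt_trans by blast+
      then have "\<not> Suc i \<le> k" "\<not> Suc k \<le> i"
        using mul_one_lt[of "Suc i" k] mul_one_lt[of "Suc k" i] lt_trans lt_irrefl
        by (metis le_neq_implies_less)+
      then show False using that by simp
    qed
    moreover have "add c (neg (mul j x)) \<in> univ N" using d dA x by (simp add: c_def)
    moreover have "add c (neg (mul l x)) \<notin> univ N" if "l \<noteq> j" for l
      using N_cosets[OF x d(1), of j l] that by (auto simp: c_def)
    ultimately show ?thesis
      unfolding p q using c cA by (intro bexI[of _ c]) (auto simp: pair_def)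
  qed
  moreover have "length (a i) = 2 \<and> set (a i) \<subseteq> univ pair"
    "length (b i) = 2 \<and> set (b i) \<subseteq> univ pair" for i
    using x by (auto simp: a_def b_def pair_def)
  moreover have "wf_fm (pair_language L) p \<and> fv p \<subseteq> {0..2} \<and> wf_fm (pair_language L) q \<and> fv q \<subseteq> {0..2}"
    using og_ar by (auto simp: p_def q_def pair_language_def og_arities_def)
  note dp[unfolded dp_minimal_def, THEN spec, THEN mp, OF assms, THEN spec, THEN spec, THEN spec,
    THEN mp, OF this]
  ultimately show False by blast
qed

end

theorem proposition3p9:
  fixes L :: "('f, 'r) og_language" and T :: "('f, 'r) fm set"
  assumes universe_large: "\<exists>h :: ('f, 'r) fm \<Rightarrow> 'm. inj h"
    and language: "og_arities L"
    and complete: "complete_theory TYPE('m) L T"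
    and o_minimal: "o_minimal_theory TYPE('m) L T"
    and extends: "\<forall>p\<in>ordered_abelian_group_axioms L. entails TYPE('m) L T p"
  shows "\<not> dp_minimal TYPE('m) (pair_language L) (dense_pair_theory TYPE('m) L T)"
proof
  assume dp: "dp_minimal TYPE('m) (pair_language L) (dense_pair_theory TYPE('m) L T)"
  have group: "omin_group L M" if "is_model L T M" for M :: "('f, 'r, 'm) interp"
    using that language o_minimal extends
    by unfold_locales (auto simp: o_minimal_theory_def entails_def og_arities_def)
  have dense: "dense_omin L M" if "is_model L T M" for M :: "('f, 'r, 'm) interp"
  proof -
    interpret omin_group L M by (rule group[OF that])
    show ?thesis by (rule dense_omin_axioms)
  qed
  obtain h :: "('f, 'r) fm \<Rightarrow> 'm" where h: "inj h" using universe_large by blast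
  obtain M0 :: "('f, 'r, 'm) interp" where M0: "is_model L T M0"
    using complete unfolding complete_theory_def by blast
  \<comment> \<open>Going through formulas, this places every limit structure in the type over which
    o-minimality of the models is assumed.\<close>
  interpret dense_omin_theory L T "h \<circ> code_skt"
  proof (rule dense_omin_theory.intro)
    show "is_theory L T" using complete by (simp add: complete_theory_def)
    show "inj (h \<circ> code_skt)" by (rule inj_compose[OF h inj_code_skt])
  qed (rule dense)
  interpret M0: omin_group L M0 by (rule group[OF M0])
  obtain M N :: "('f, 'r, 'm) interp" where M: "is_model L T M" and N: "elementary_sub L N M"
    "univ N \<noteq> univ M" "\<forall>a\<in>univ M. \<forall>b\<in>univ M. less_in L M a b \<longrightarrow>
      (\<exists>c\<in>univ N. less_in L M a c \<and> less_in L M c b)"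
    using dense_elementary_sub[OF M0 M0.infinite_univ] by blast
  interpret G: omin_group L M by (rule group[OF M])
  interpret P: omin_pair L M N
  proof
    fix a b assume "G.lt a b"
    then show "\<exists>c\<in>univ N. G.lt a c \<and> G.lt c b" using N(3) G.lt_in[of a b] by (simp add: G.lt_def)
  qed (use N in auto)
  have "dense_pair L T P.pair" by (rule P.dense_pair_pair[OF M])
  then have "is_model (pair_language L) (dense_pair_theory TYPE('m) L T) P.pair"
    using P.is_struct_pair by (auto simp: is_model_def dense_pair_theory_def)
  from P.not_dp_minimal[OF this] dp show False by contradiction
qed

end
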